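(* Let $(S,d)$ be a complete and bounded metric space, let $\{\mathbf{X}^n\}_{n\in\mathbb{N}_0}$ be a quasi-visual approximation of $(S,d)$ by non-empty sets, and let $d_\infty$ be a visual metric (in the sense of Gromov hyperbolic spaces) on $\partial_\infty\Gamma$, where $\Gamma=\Gamma(\{\mathbf{X}^n\})$ is the associated tile graph. Then the natural identification $\Phi\colon(S,d)\to(\partial_\infty\Gamma,d_\infty)$ is a quasisymmetry.
   Context: $\mathbb{N}_0=\{0,1,2,\dots\}$, $\mathbb{N}=\{1,2,\dots\}$. A bijection $\varphi\colon (S,d)\to (T,\varrho)$ is a quasisymmetry if there is a homeomorphism $\eta\colon[0,\infty)\to[0,\infty)$ with $\frac{\varrho(\varphi(x),\varphi(y))}{\varrho(\varphi(x),\varphi(z))}\le\eta\left(\frac{d(x,y)}{d(x,z)}\right)$ for all $x,y,z\in S$ with $x\ne z$. Let $\{\mathbf{X}^n\}_{n\in\mathbb{N}_0}$ be a sequence of covers of $S$ (collections, possibly infinite, of subsets of $S$ with union $S$). Elements of $\mathbf{X}^n$ are called $n$-tiles. A chain of $n$-tiles of length $k$ from $X$ to $Y$ is a sequence $X_0=X,\dots,X_k=Y$ in $\mathbf{X}^n$ with $X_j\cap X_{j+1}\ne\emptyset$ for all $j<k$; $U_w(X)$ is the union of all $Y\in\mathbf{X}^n$ for which there is a chain of $n$-tiles from $X$ to $Y$ of length $\le w$. For a bounded metric space $(S,d)$ with more than one point, a quasi-visual approximation of width $w\in\mathbb{N}_0$ is a sequence $\{\mathbf{X}^n\}_{n\in\mathbb{N}_0}$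 of covers of $S$ with $\mathbf{X}^0=\{S\}$ for which there are constants $C\ge1$, $k_0\in\mathbb{N}$, $\lambda\in(0,1)$ such that for all $n\in\mathbb{N}_0$: (1) $\frac1C\operatorname{diam}(Y)\le\operatorname{diam}(X)\le C\operatorname{diam}(Y)$ for all $X,Y\in\mathbf{X}^n$ with $X\cap Y\neq\emptyset$; (2) $\operatorname{dist}(X,Y)\ge\frac1C\operatorname{diam}(X)$ for all $X,Y\in\mathbf{X}^n$ with $U_w(X)\cap U_w(Y)=\emptyset$, where $\operatorname{dist}(X,Y)=\inf\{d(x,y):x\in X,\,y\in Y\}$; (3) $\frac1C\operatorname{diam}(Y)\le\operatorname{diam}(X)\le C\operatorname{diam}(Y)$ for all $X\in\mathbf{X}^n$, $Y\in\mathbf{X}^{n+1}$ with $X\cap Y\ne\emptyset$; (4) $\operatorname{diam}(Y)\le\lambda\operatorname{diam}(X)$ for all $X\in\mathbf{X}^n$, $Y\in\mathbf{X}^{n+k_0}$ with $X\cap Y\ne\emptyset$. Without mention of width, some width $w\in\mathbb{N}_0$ is meant. Tile graph: $\mathbf{X}=\bigsqcup_{n}\mathbf{X}^n$ is the formal disjoint union (the same subset on two different levels gives two different elements), $|X|=n$ is the level of $X\in\mathbf{X}^n$. The tile graph $\Gamma$ has vertex set $\mathbf{X}$; distinct vertices $X,Y$ are joined by an edge iff $X\cap Y\neq\emptyset$ and $\big||X|-|Y|\big|\le1$. $|X-Y|$ is the combinatorial (path) distance in $\Gamma$ and $(X\cdot Y)=\frac12(|X|+|Y|-|X-Y|)$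 is the Gromov product. In the present situation $\Gamma$ is Gromov hyperbolic, i.e. there is $C\ge0$ with $(X\cdot Y)\ge\min\{(X\cdot Z),(Z\cdot Y)\}-C$ for all $X,Y,Z\in\mathbf{X}$. Boundary: a sequence $\{X_i\}$ in $\mathbf{X}$ converges at infinity if $\lim_{i,j\to\infty}(X_i\cdot X_j)=\infty$; two such sequences are equivalent, $\{X_i\}\sim\{Y_i\}$, if $\lim_{i\to\infty}(X_i\cdot Y_i)=\infty$ (an equivalence relation by hyperbolicity). $\partial_\infty\Gamma$ is the set of equivalence classes $[\{X_i\}]$. For $X^\infty,Y^\infty\in\partial_\infty\Gamma$ put $(X^\infty\cdot Y^\infty)=\sup\{\liminf_{i\to\infty}(X_i\cdot Y_i):\{X_i\}\in X^\infty,\{Y_i\}\in Y^\infty\}\in[0,\infty]$. A metric $d_\infty$ on $\partial_\infty\Gamma$ is visual (in the sense of Gromov hyperbolic spaces) if there are $\Lambda_\infty>1$ and $C\ge1$ with $\frac1C\Lambda_\infty^{-(X^\infty\cdot Y^\infty)}\le d_\infty(X^\infty,Y^\infty)\le C\Lambda_\infty^{-(X^\infty\cdot Y^\infty)}$ for all $X^\infty,Y^\infty$ (with $\Lambda_\infty^{-\infty}=0$). Natural identification: for $x\in S$, a natural geodesic of $x$ is a sequence $\{X^n\}_{n\in\mathbb{N}_0}$ with $x\in X^n\in\mathbf{X}^n$ for all $n$; such sequences converge at infinity and any two natural geodesics of $x$ are equivalent. Hence $\Phi\colon S\to\partial_\infty\Gamma$, $\Phi(x)=[\{X^n\}]$ for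 any natural geodesic $\{X^n\}$ of $x$, is well defined. *)

theory Defs
  imports "HOL-Analysis.Analysis"
begin

section \<open>Quasisymmetries\<close>

definition quasisymmetry ::
  "'a set \<Rightarrow> ('a \<Rightarrow> 'a \<Rightarrow> real) \<Rightarrow> 'b set \<Rightarrow> ('b \<Rightarrow> 'b \<Rightarrow> real) \<Rightarrow> ('a \<Rightarrow> 'b) \<Rightarrow> bool" where
  "quasisymmetry S d T \<rho> \<phi> \<longleftrightarrow>
     bij_betw \<phi> S T \<and>
     (\<exists>\<eta> \<eta>' :: real \<Rightarrow> real. homeomorphism {0..} {0..} \<eta> \<eta>' \<and>
        (\<forall>x\<in>S. \<forall>y\<in>S. \<forall>z\<in>S. x \<noteq> z \<longrightarrow>
           \<rho> (\<phi> x) (\<phi> y) / \<rho> (\<phi> x) (\<phi> z) \<le> \<eta> (d x y / d x z)))"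

section \<open>Quasi-visual approximations\<close>

text \<open>Diameter and distance of sets with respect to an explicit metric, with the conventions of
  the type-class constants \<^const>\<open>diameter\<close> and \<^const>\<open>setdist\<close>. The supremum is only meaningful
  for bounded sets.\<close>

definition mdiam :: "('a \<Rightarrow> 'a \<Rightarrow> real) \<Rightarrow> 'a set \<Rightarrow> real" where
  "mdiam d A = (if A = {} then 0 else Sup {d x y | x y. x \<in> A \<and> y \<in> A})"

definition msetdist :: "('a \<Rightarrow> 'a \<Rightarrow> real) \<Rightarrow> 'a set \<Rightarrow> 'a set \<Rightarrow> real" where
  "msetdist d A B = (if A = {} \<or> B = {} then 0 else Inf {d x y | x y. x \<in> A \<and> y \<in> B})"

text \<open>In the following two definitions \<open>T\<close> is the set of all tiles of one fixed level.\<close>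

definition tile_chain :: "'a set set \<Rightarrow> nat \<Rightarrow> 'a set \<Rightarrow> 'a set \<Rightarrow> bool" where
  "tile_chain T k A B \<longleftrightarrow>
     (\<exists>c :: nat \<Rightarrow> 'a set. c 0 = A \<and> c k = B \<and> (\<forall>j\<le>k. c j \<in> T) \<and>
        (\<forall>j<k. c j \<inter> c (Suc j) \<noteq> {}))"

definition tile_nbhd :: "'a set set \<Rightarrow> nat \<Rightarrow> 'a set \<Rightarrow> 'a set" where
  "tile_nbhd T w A = \<Union> {B \<in> T. \<exists>k\<le>w. tile_chain T k A B}"

text \<open>The requirement \<open>A \<noteq> {}\<close>, \<open>B \<noteq> {}\<close> in the second condition accounts for the convention
  that the infimum of the empty set is infinite, so that the condition is void for empty tiles.\<close>

definition quasi_visual_approximation ::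
  "'a set \<Rightarrow> ('a \<Rightarrow> 'a \<Rightarrow> real) \<Rightarrow> nat \<Rightarrow> (nat \<Rightarrow> 'a set set) \<Rightarrow> bool" where
  "quasi_visual_approximation S d w X \<longleftrightarrow>
     Metric_space S d \<and> Metric_space.mbounded S d S \<and> (\<exists>x\<in>S. \<exists>y\<in>S. x \<noteq> y) \<and>
     (\<forall>n. \<Union> (X n) = S) \<and> X 0 = {S} \<and>
     (\<exists>(C::real) (k0::nat) (lam::real). C \<ge> 1 \<and> k0 \<ge> 1 \<and> 0 < lam \<and> lam < 1 \<and>
       (\<forall>n.
         (\<forall>A\<in>X n. \<forall>B\<in>X n. A \<inter> B \<noteq> {} \<longrightarrow>
            1 / C * mdiam d B \<le> mdiam d A \<and> mdiam d A \<le> C * mdiam d B) \<and>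
         (\<forall>A\<in>X n. \<forall>B\<in>X n. A \<noteq> {} \<and> B \<noteq> {} \<and> tile_nbhd (X n) w A \<inter> tile_nbhd (X n) w B = {} \<longrightarrow>
            msetdist d A B \<ge> 1 / C * mdiam d A) \<and>
         (\<forall>A\<in>X n. \<forall>B\<in>X (n + 1). A \<inter> B \<noteq> {} \<longrightarrow>
            1 / C * mdiam d B \<le> mdiam d A \<and> mdiam d A \<le> C * mdiam d B) \<and>
         (\<forall>A\<in>X n. \<forall>B\<in>X (n + k0). A \<inter> B \<noteq> {} \<longrightarrow>
            mdiam d B \<le> lam * mdiam d A)))"

section \<open>The tile graph\<close>

text \<open>A vertex is a pair of a level and a tile of that level; this makes the union of the levels
  disjoint.\<close>

definition tiles :: "(nat \<Rightarrow> 'a set set) \<Rightarrow> (nat \<times> 'a set) set" where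
  "tiles X = (SIGMA n:UNIV. X n)"

definition tile_edges :: "(nat \<Rightarrow> 'a set set) \<Rightarrow> ((nat \<times> 'a set) \<times> (nat \<times> 'a set)) set" where
  "tile_edges X =
     {(u, v). u \<in> tiles X \<and> v \<in> tiles X \<and> u \<noteq> v \<and> snd u \<inter> snd v \<noteq> {} \<and>
        \<bar>int (fst u) - int (fst v)\<bar> \<le> 1}"

text \<open>The length of a shortest path. The value is unspecified if there is no path, but a tile graph
  with non-empty tiles and \<open>X 0 = {S}\<close> is connected.\<close>

definition tile_gdist :: "(nat \<Rightarrow> 'a set set) \<Rightarrow> nat \<times> 'a set \<Rightarrow> nat \<times> 'a set \<Rightarrow> nat" where
  "tile_gdist X u v = (LEAST k. (u, v) \<in> tile_edges X ^^ k)"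

definition gromov_product :: "(nat \<Rightarrow> 'a set set) \<Rightarrow> nat \<times> 'a set \<Rightarrow> nat \<times> 'a set \<Rightarrow> real" where
  "gromov_product X u v = (real (fst u) + real (fst v) - real (tile_gdist X u v)) / 2"

section \<open>The boundary at infinity\<close>

definition converges_at_infinity :: "(nat \<Rightarrow> 'a set set) \<Rightarrow> (nat \<Rightarrow> nat \<times> 'a set) \<Rightarrow> bool" where
  "converges_at_infinity X s \<longleftrightarrow>
     range s \<subseteq> tiles X \<and>
     filterlim (\<lambda>(i, j). gromov_product X (s i) (s j)) at_top (sequentially \<times>\<^sub>F sequentially)"

definition infinity_rel ::
  "(nat \<Rightarrow> 'a set set) \<Rightarrow> ((nat \<Rightarrow> nat \<times> 'a set) \<times> (nat \<Rightarrow> nat \<times> 'a set)) set" where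
  "infinity_rel X =
     {(s, t). converges_at_infinity X s \<and> converges_at_infinity X t \<and>
        filterlim (\<lambda>i. gromov_product X (s i) (t i)) at_top sequentially}"

definition boundary_at_infinity :: "(nat \<Rightarrow> 'a set set) \<Rightarrow> (nat \<Rightarrow> nat \<times> 'a set) set set" where
  "boundary_at_infinity X = {s. converges_at_infinity X s} // infinity_rel X"

definition boundary_product ::
  "(nat \<Rightarrow> 'a set set) \<Rightarrow> (nat \<Rightarrow> nat \<times> 'a set) set \<Rightarrow> (nat \<Rightarrow> nat \<times> 'a set) set \<Rightarrow> ereal" where
  "boundary_product X P Q =
     Sup {liminf (\<lambda>i. ereal (gromov_product X (s i) (t i))) | s t. s \<in> P \<and> t \<in> Q}"

text \<open>\<open>L\<close> to the power \<open>- t\<close>, with value \<open>0\<close> at \<open>t = \<infinity>\<close>. The value at \<open>t = -\<infinity>\<close> is irrelevant,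
  since Gromov products in a tile graph are non-negative.\<close>

definition neg_power :: "real \<Rightarrow> ereal \<Rightarrow> real" where
  "neg_power L t = (if t = \<infinity> then 0 else L powr (- real_of_ereal t))"

definition visual_metric ::
  "(nat \<Rightarrow> 'a set set) \<Rightarrow>
     ((nat \<Rightarrow> nat \<times> 'a set) set \<Rightarrow> (nat \<Rightarrow> nat \<times> 'a set) set \<Rightarrow> real) \<Rightarrow> bool" where
  "visual_metric X D \<longleftrightarrow>
     Metric_space (boundary_at_infinity X) D \<and>
     (\<exists>L C :: real. L > 1 \<and> C \<ge> 1 \<and>
        (\<forall>P\<in>boundary_at_infinity X. \<forall>Q\<in>boundary_at_infinity X.
           1 / C * neg_power L (boundary_product X P Q) \<le> D P Q \<and>
           D P Q \<le> C * neg_power L (boundary_product X P Q)))"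

section \<open>The natural identification\<close>

definition natural_geodesic ::
  "(nat \<Rightarrow> 'a set set) \<Rightarrow> 'a \<Rightarrow> (nat \<Rightarrow> nat \<times> 'a set) \<Rightarrow> bool" where
  "natural_geodesic X x g \<longleftrightarrow> (\<forall>n. fst (g n) = n \<and> snd (g n) \<in> X n \<and> x \<in> snd (g n))"

text \<open>The definite description is proper because any two natural geodesics of a point are
  equivalent.\<close>

definition natural_identification ::
  "(nat \<Rightarrow> 'a set set) \<Rightarrow> 'a \<Rightarrow> (nat \<Rightarrow> nat \<times> 'a set) set" where
  "natural_identification X x = (THE P. \<exists>g. natural_geodesic X x g \<and> P = infinity_rel X `` {g})"

end

theory Submission
  imports Defs
begin

text \<open>The proof reduces both sides of the comparison to one combinatorial relation on points: \<open>x\<close> and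
  \<open>y\<close> are \<^emph>\<open>chained at level \<open>k\<close>\<close> if they can be joined by a bounded number of steps, each inside
  one \<open>k\<close>-tile.

  On the metric side, let \<open>A\<close> be a \<open>k\<close>-tile containing \<open>x\<close>. A chain of bounded length at level \<open>k\<close>
  stays within a bounded multiple of \<open>mdiam d A\<close>, because intersecting tiles of one level have
  comparable diameters (\<open>chain_dist_le\<close>). Conversely, if \<open>d x y\<close> is small compared with
  \<open>mdiam d A\<close>, then the tiles at \<open>x\<close> and \<open>y\<close> have intersecting \<open>w\<close>-neighbourhoods, so \<open>x\<close> and \<open>y\<close>
  are chained at level \<open>k\<close> (\<open>chain_if_dist_less\<close>).

  On the graph side, let \<open>x\<close> and \<open>y\<close> be points of two vertices \<open>u\<close> and \<open>v\<close>. If \<open>x\<close> and \<open>y\<close> are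
  chained at a level \<open>k\<close> below both vertices, then descending from \<open>u\<close> to level \<open>k\<close>, following the
  chain and ascending to \<open>v\<close> shows that the Gromov product is at least \<open>k\<close> up to an additive constant
  (\<open>gromov_product_ge\<close>). The converse (\<open>gromov_product_imp_chain\<close>) is the heart of the proof: if
  the Gromov product is at least \<open>k + r\<close>, then a geodesic from \<open>u\<close> to \<open>v\<close> has a vertex such
  that \<open>i\<close> steps away from it, in either direction, the level is at least \<open>k + r + i\<close>. Since diameters
  decay geometrically with the level, the whole geodesic stays near a single
  \<open>k\<close>-tile, and therefore \<open>x\<close> and \<open>y\<close> are chained at level \<open>k\<close>, with a bound on the length that does
  not depend on \<open>u\<close> and \<open>v\<close>.

  So the Gromov product of two vertices agrees, up to an additive constant, with the largest level
  not above theirs at which points of the two tiles are chained. As chains can be concatenated, this contains the hyperbolicity of the tile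
  graph, in particular that equivalence at infinity is an equivalence relation. It also shows that
  the points picked from a sequence converging at infinity form a Cauchy sequence, which yields
  the bijectivity of the natural identification.

  Finally, let \<open>p\<close> and \<open>q\<close> be the Gromov products at infinity of \<open>x, z\<close> and of \<open>x, y\<close>. Then
  \<open>d x z\<close> is at most, and \<open>d x y\<close> at least, a constant times the diameter of a tile at \<open>x\<close> of level
  about \<open>p\<close> and about \<open>q\<close>, respectively. Diameters of tiles at \<open>x\<close> change at most and at least
  exponentially with the level, so \<open>d x y / d x z\<close> is bounded below by an exponential of \<open>p - q\<close>
  (with one base for \<open>p \<ge> q\<close>, another one for \<open>p \<le> q\<close>), whereas the ratio of the visual distances is
  comparable to the power \<open>L powr (p - q)\<close>. Eliminating \<open>p - q\<close> bounds the latter ratio by a constant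
  times the larger of two powers of the former.\<close>

section \<open>Diameters and distances of sets\<close>

context Metric_space
begin

lemma dist_le_mdiam:
  assumes "mbounded A" "x \<in> A" "y \<in> A"
  shows "d x y \<le> mdiam d A"
proof -
  obtain B where "\<forall>x\<in>A. \<forall>y\<in>A. d x y \<le> B"
    using assms(1) by (auto simp: mbounded_alt)
  then have "bdd_above {d x y | x y. x \<in> A \<and> y \<in> A}"
    by (auto simp: bdd_above_def)
  then have "d x y \<le> Sup {d x y | x y. x \<in> A \<and> y \<in> A}"
    using assms by (intro cSup_upper) auto
  then show ?thesis
    using assms by (auto simp: mdiam_def)
qed

lemma msetdist_le_dist:
  assumes "x \<in> A" "y \<in> B"
  shows "msetdist d A B \<le> d x y"
proof -
  have "bdd_below {d x y | x y. x \<in> A \<and> y \<in> B}"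
    unfolding bdd_below_def using nonneg by blast
  then have "Inf {d x y | x y. x \<in> A \<and> y \<in> B} \<le> d x y"
    using assms by (intro cInf_lower) auto
  then show ?thesis
    using assms by (auto simp: msetdist_def)
qed

end

section \<open>Chains of points\<close>

text \<open>Chains are handled as powers of this relation on points, so that they can be concatenated at a
  point without choosing tiles through it.\<close>

definition same_tile :: "(nat \<Rightarrow> 'a set set) \<Rightarrow> nat \<Rightarrow> ('a \<times> 'a) set" where
  "same_tile X k = {(x, y). \<exists>A\<in>X k. x \<in> A \<and> y \<in> A}"

lemma same_tile_relpow_sym: "(x, y) \<in> same_tile X k ^^ N \<Longrightarrow> (y, x) \<in> same_tile X k ^^ N"
proof (induction N arbitrary: y)
  case (Suc N)
  then obtain z where "(x, z) \<in> same_tile X k ^^ N" "(z, y) \<in> same_tile X k"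
    by auto
  with Suc.IH have "(z, x) \<in> same_tile X k ^^ N" "(y, z) \<in> same_tile X k"
    by (auto simp: same_tile_def)
  then show ?case
    by (meson relpow_Suc_I2)
qed auto

text \<open>A chain of \<open>N + 1\<close> tiles has length \<open>N\<close> but gives \<open>N + 1\<close> steps between points. Counting the
  tiles rather than the intersections makes concatenation at a common point additive.\<close>

lemma tile_chain_imp_same_tile_relpow:
  assumes "tile_chain (X k) N A B" "x \<in> A" "y \<in> B"
  shows "(x, y) \<in> same_tile X k ^^ Suc N"
  using assms
proof (induction N arbitrary: B y)
  case 0
  then show ?case
    by (auto simp: tile_chain_def same_tile_def)
next
  case (Suc N)
  then obtain c where c: "c 0 = A" "c (Suc N) = B" "\<And>j. j \<le> Suc N \<Longrightarrow> c j \<in> X k"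
    "\<And>j. j < Suc N \<Longrightarrow> c j \<inter> c (Suc j) \<noteq> {}"
    by (auto simp: tile_chain_def)
  then obtain z where z: "z \<in> c N" "z \<in> c (Suc N)"
    by blast
  have "tile_chain (X k) N A (c N)"
    unfolding tile_chain_def using c by (intro exI[of _ c]) auto
  then have "(x, z) \<in> same_tile X k ^^ Suc N"
    using Suc.IH Suc.prems z by blast
  moreover have "(z, y) \<in> same_tile X k"
    using z c Suc.prems by (auto simp: same_tile_def)
  ultimately show ?case
    by (meson relpow_Suc_I)
qed

section \<open>A modulus of quasisymmetry\<close>

text \<open>The inverse of the larger of two increasing bijections is the smaller of their inverses.\<close>

lemma homeomorphism_max_powr:
  fixes G \<alpha> \<beta> :: real
  assumes "0 < G" "0 < \<alpha>" "0 < \<beta>"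
  shows "homeomorphism {0..} {0..} (\<lambda>t. G * max (t powr \<alpha>) (t powr \<beta>))
    (\<lambda>u. min ((u / G) powr (1 / \<alpha>)) ((u / G) powr (1 / \<beta>)))"
    (is "homeomorphism _ _ ?f ?g")
proof (rule homeomorphismI)
  show "continuous_on {0..} ?f" "continuous_on {0..} ?g"
    using assms by (intro continuous_intros continuous_on_powr'; simp)+
  show "?f ` {0..} \<subseteq> {0..}" "?g ` {0..} \<subseteq> {0..}"
    using assms by (auto simp: le_max_iff_disj)
  fix t :: real
  assume t: "t \<in> {0..}"
  have mono: "(a powr p) \<le> b powr p" if "0 \<le> a" "a \<le> b" "0 < p" for a b p :: real
    using that by (intro powr_mono2) auto
  have inv: "(a powr p) powr (1 / p) = a" "(a powr (1 / p)) powr p = a" if "0 \<le> a" "0 < p" for a p :: real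
    using that by (simp_all add: powr_powr)
  show "?g (?f t) = t"
  proof -
    have "t \<le> (max (t powr \<alpha>) (t powr \<beta>)) powr (1 / \<alpha>)" "t \<le> (max (t powr \<alpha>) (t powr \<beta>)) powr (1 / \<beta>)"
      using mono[of "t powr \<alpha>" "max (t powr \<alpha>) (t powr \<beta>)" "1 / \<alpha>"]
        mono[of "t powr \<beta>" "max (t powr \<alpha>) (t powr \<beta>)" "1 / \<beta>"] assms t inv by auto
    then show ?thesis
      using assms t inv by (auto simp: min_def max_def split: if_splits)
  qed
  show "?f (?g t) = t"
  proof -
    define u where "u = t / G"
    have u: "0 \<le> u" "G * u = t"
      using t assms by (auto simp: u_def)
    have "(min (u powr (1 / \<alpha>)) (u powr (1 / \<beta>))) powr \<alpha> \<le> u" "(min (u powr (1 / \<alpha>)) (u powr (1 / \<beta>))) powr \<beta> \<le> u"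
      using mono[of "min (u powr (1 / \<alpha>)) (u powr (1 / \<beta>))" "u powr (1 / \<alpha>)" \<alpha>]
        mono[of "min (u powr (1 / \<alpha>)) (u powr (1 / \<beta>))" "u powr (1 / \<beta>)" \<beta>] assms u inv by auto
    then have "max ((min (u powr (1 / \<alpha>)) (u powr (1 / \<beta>))) powr \<alpha>) ((min (u powr (1 / \<alpha>)) (u powr (1 / \<beta>))) powr \<beta>) = u"
      using assms u inv by (auto simp: min_def max_def split: if_splits)
    then show ?thesis
      by (simp add: u_def[symmetric] u(2))
  qed
qed

text \<open>Converts an exponential bound with base \<open>b\<close> into one with base \<open>L\<close>; this is where the exponents
  of the modulus of quasisymmetry come from.\<close>

lemma powr_change_base_le:
  assumes "1 < b" "1 < L" "b powr s \<le> c * t" "0 < c" "0 \<le> t"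
  shows "L powr s \<le> c powr log b L * t powr log b L"
proof -
  have "L powr s = (b powr s) powr log b L"
    using assms by (metis mult.commute powr_log_cancel powr_powr less_trans zero_less_one less_irrefl)
  also have "\<dots> \<le> (c * t) powr log b L"
    using assms by (intro powr_mono2) auto
  also have "\<dots> = c powr log b L * t powr log b L"
    using assms by (simp add: powr_mult)
  finally show ?thesis .
qed

section \<open>Diameters of tiles\<close>

text \<open>Of the two-sided bounds between intersecting tiles of one level, one side is kept, as the other
  follows by exchanging the tiles.\<close>

locale tile_approximation = Metric_space S d for S :: "'a set" and d +
  fixes X :: "nat \<Rightarrow> 'a set set" and w k0 :: nat and C lam :: real
  assumes bounded: "mbounded S"
    and nontrivial: "\<exists>x\<in>S. \<exists>y\<in>S. x \<noteq> y"
    and cover: "\<Union> (X n) = S"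
    and level_zero: "X 0 = {S}"
    and nonempty: "A \<in> X n \<Longrightarrow> A \<noteq> {}"
    and C_ge_1: "1 \<le> C"
    and k0_pos: "0 < k0"
    and lam_pos: "0 < lam"
    and lam_less_1: "lam < 1"
    and mdiam_le_neighbour:
      "A \<in> X n \<Longrightarrow> B \<in> X n \<Longrightarrow> A \<inter> B \<noteq> {} \<Longrightarrow> mdiam d A \<le> C * mdiam d B"
    and mdiam_le_msetdist:
      "A \<in> X n \<Longrightarrow> B \<in> X n \<Longrightarrow> tile_nbhd (X n) w A \<inter> tile_nbhd (X n) w B = {}
        \<Longrightarrow> mdiam d A \<le> C * msetdist d A B"
    and mdiam_le_child:
      "A \<in> X n \<Longrightarrow> B \<in> X (Suc n) \<Longrightarrow> A \<inter> B \<noteq> {} \<Longrightarrow> mdiam d A \<le> C * mdiam d B"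
    and mdiam_le_parent:
      "A \<in> X n \<Longrightarrow> B \<in> X (Suc n) \<Longrightarrow> A \<inter> B \<noteq> {} \<Longrightarrow> mdiam d B \<le> C * mdiam d A"
    and mdiam_shrink:
      "A \<in> X n \<Longrightarrow> B \<in> X (n + k0) \<Longrightarrow> A \<inter> B \<noteq> {} \<Longrightarrow> mdiam d B \<le> lam * mdiam d A"
begin

text \<open>The decay rate per level: \<open>k0\<close> levels together contribute the factor \<open>lam\<close>. The constant \<open>K\<close>
  absorbs the up to \<open>k0 - 1\<close> levels left over when a number of levels is divided by \<open>k0\<close>.\<close>

definition rho :: real where
  "rho = root k0 lam"

definition K :: real where
  "K = C ^ k0 / lam"

lemma rho_pos: "0 < rho" and rho_less_1: "rho < 1" and rho_power: "rho ^ k0 = lam"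
  using k0_pos lam_pos lam_less_1 real_root_lt_1_iff[of k0 lam]
  by (auto simp: rho_def real_root_gt_0_iff)

lemma K_ge_1: "1 \<le> K"
proof -
  have "1 \<le> C ^ k0"
    using C_ge_1 by (rule one_le_power)
  then show ?thesis
    using lam_pos lam_less_1 by (simp add: K_def field_simps)
qed

lemma tile_subset: "A \<in> X n \<Longrightarrow> A \<subseteq> S"
  using cover by blast

lemma tile_through:
  assumes "x \<in> S"
  obtains A where "A \<in> X n" "x \<in> A"
  using assms cover by blast

lemma dist_le_tile: "A \<in> X n \<Longrightarrow> x \<in> A \<Longrightarrow> y \<in> A \<Longrightarrow> d x y \<le> mdiam d A"
  using dist_le_mdiam bounded mbounded_subset tile_subset by metis

lemma mdiam_nonneg: "A \<in> X n \<Longrightarrow> 0 \<le> mdiam d A"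
  using dist_le_tile nonempty nonneg by (metis all_not_in_conv order_trans)

text \<open>The diameter of \<open>S\<close> is positive, and passing to a tile of the next level costs at most the
  factor \<open>C\<close>. In particular no tile is a single point.\<close>

lemma mdiam_pos: "A \<in> X n \<Longrightarrow> 0 < mdiam d A"
proof (induction n arbitrary: A)
  case 0
  obtain x y where "x \<in> S" "y \<in> S" "x \<noteq> y"
    using nontrivial by blast
  then have "0 < d x y"
    by simp
  also have "d x y \<le> mdiam d S"
    using dist_le_mdiam bounded \<open>x \<in> S\<close> \<open>y \<in> S\<close> by blast
  finally show ?case
    using 0 level_zero by simp
next
  case (Suc n)
  obtain x where "x \<in> A"
    using nonempty Suc.prems by blast
  then obtain B where "B \<in> X n" "x \<in> B"
    using tile_through tile_subset Suc.prems by blast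
  then have "0 < mdiam d B" "mdiam d B \<le> C * mdiam d A"
    using Suc.IH mdiam_le_child Suc.prems \<open>x \<in> A\<close> by blast+
  then show ?case
    using C_ge_1 by (metis less_le_trans mult_le_0_iff not_le order_trans zero_le_one linorder_not_less)
qed

lemma mdiam_growth_le:
  assumes "x \<in> A" "x \<in> B" "A \<in> X n" "B \<in> X (n + j)"
  shows "mdiam d A \<le> C ^ Suc j * mdiam d B" "mdiam d B \<le> C ^ Suc j * mdiam d A"
  using assms(2,4)
proof (induction j arbitrary: B)
  case 0
  { case 1 then show ?case using assms mdiam_le_neighbour[of A n B] by auto }
  { case 2 then show ?case using assms mdiam_le_neighbour[of B n A] by auto }
next
  case (Suc j)
  { case 1
    then obtain D where D: "D \<in> X (n + j)" "x \<in> D"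
      using tile_through assms tile_subset by blast
    then have "mdiam d A \<le> C ^ Suc j * mdiam d D" "mdiam d D \<le> C * mdiam d B"
      using Suc.IH 1 mdiam_le_child[of D "n + j" B] by auto
    then have "mdiam d A \<le> C ^ Suc j * (C * mdiam d B)"
      using C_ge_1 by (smt (verit) mult_left_mono zero_le_power)
    then show ?case
      by (simp add: ac_simps) }
  { case 2
    then obtain D where D: "D \<in> X (n + j)" "x \<in> D"
      using tile_through assms tile_subset by blast
    then have "mdiam d D \<le> C ^ Suc j * mdiam d A" "mdiam d B \<le> C * mdiam d D"
      using Suc.IH 2 mdiam_le_parent[of D "n + j" B] by auto
    then have "mdiam d B \<le> C * (C ^ Suc j * mdiam d A)"
      using C_ge_1 by (smt (verit) mult_left_mono)
    then show ?case
      by (simp add: ac_simps) }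
qed

lemma mdiam_shrink_power:
  assumes "x \<in> A" "x \<in> B" "A \<in> X n" "B \<in> X (n + q * k0)" "0 < q"
  shows "mdiam d B \<le> lam ^ q * mdiam d A"
  using assms(5,2,4)
proof (induction q arbitrary: B rule: nat_induct_non_zero)
  case 1
  then show ?case
    using assms mdiam_shrink[of A n B] by auto
next
  case (Suc q)
  then obtain D where D: "D \<in> X (n + q * k0)" "x \<in> D"
    using tile_through assms tile_subset by blast
  then have "mdiam d D \<le> lam ^ q * mdiam d A" "mdiam d B \<le> lam * mdiam d D"
    using Suc mdiam_shrink[of D "n + q * k0" B] by (auto simp: ac_simps)
  then have "mdiam d B \<le> lam * (lam ^ q * mdiam d A)"
    using lam_pos by (smt (verit) mult_left_mono)
  then show ?case
    by (simp add: ac_simps)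
qed

lemma mdiam_decay:
  assumes "x \<in> A" "x \<in> B" "A \<in> X n" "B \<in> X (n + j)"
  shows "mdiam d B \<le> K * rho ^ j * mdiam d A"
proof -
  define q where "q = j div k0"
  define i where "i = j mod k0"
  have j: "j = i + q * k0" and i: "i < k0"
    using k0_pos by (auto simp: q_def i_def)
  have "rho ^ k0 \<le> rho ^ i"
    using i rho_pos rho_less_1 by (intro power_decreasing) auto
  then have "lam * lam ^ q \<le> rho ^ i * lam ^ q"
    using lam_pos by (intro mult_right_mono) (auto simp: rho_power)
  also have "rho ^ i * lam ^ q = rho ^ j"
    by (simp add: j power_add power_mult rho_power mult.commute[of q])
  finally have lamq: "lam ^ q \<le> rho ^ j / lam"
    using lam_pos by (simp add: field_simps)
  have Ci: "C ^ Suc i \<le> C ^ k0"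
    using i C_ge_1 by (intro power_increasing) auto
  obtain D where D: "D \<in> X (n + i)" "x \<in> D"
    using tile_through assms tile_subset by blast
  have DA: "mdiam d D \<le> C ^ Suc i * mdiam d A"
    using mdiam_growth_le(2)[of x A D n i] D assms by auto
  have "mdiam d B \<le> lam ^ q * (C ^ Suc i * mdiam d A)"
  proof (cases "q = 0")
    case True
    then show ?thesis
      using mdiam_growth_le(2)[of x A B n j] assms by (simp add: j)
  next
    case False
    then have "mdiam d B \<le> lam ^ q * mdiam d D"
      using mdiam_shrink_power[of x D B "n + i" q] D assms by (auto simp: j ac_simps)
    also have "\<dots> \<le> lam ^ q * (C ^ Suc i * mdiam d A)"
      using DA lam_pos by (intro mult_left_mono) auto
    finally show ?thesis .
  qed
  also have "\<dots> \<le> rho ^ j / lam * (C ^ k0 * mdiam d A)"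
    using lamq Ci mdiam_nonneg[OF assms(3)] lam_pos rho_pos C_ge_1
    by (intro mult_mono mult_right_mono) auto
  finally show ?thesis
    by (simp add: K_def ac_simps)
qed

section \<open>Chains and the metric\<close>

lemma same_tile_in_S: "(x, y) \<in> same_tile X k \<Longrightarrow> x \<in> S \<and> y \<in> S"
  using cover by (auto simp: same_tile_def)

lemma relpow_in_S: "(x, y) \<in> same_tile X k ^^ N \<Longrightarrow> x \<in> S \<Longrightarrow> y \<in> S"
  by (cases N) (auto dest: same_tile_in_S)

lemma same_tile_relpow_mono:
  assumes "(x, y) \<in> same_tile X k ^^ M" "M \<le> N" "x \<in> S"
  shows "(x, y) \<in> same_tile X k ^^ N"
  using assms(2)
proof (induction N rule: dec_induct)
  case (step N)
  moreover have "(y, y) \<in> same_tile X k"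
    using relpow_in_S[OF assms(1,3)] cover by (fastforce simp: same_tile_def)
  ultimately show ?case
    by (meson relpow_Suc_I)
qed (rule assms(1))

lemma same_tile_relpow_refl: "x \<in> S \<Longrightarrow> (x, x) \<in> same_tile X k ^^ N"
  by (rule same_tile_relpow_mono[of x x 0]) auto

text \<open>Consecutive tiles of the chain intersect, and so do the end tiles and the given ones; each of
  the \<open>N + 1\<close> intersections costs the factor \<open>C\<close>.\<close>

lemma chain_mdiam_le:
  assumes "(x, y) \<in> same_tile X k ^^ N" "x \<in> A" "A \<in> X k" "y \<in> B" "B \<in> X k"
  shows "mdiam d B \<le> C ^ Suc N * mdiam d A"
  using assms(1,4,5)
proof (induction N arbitrary: y B)
  case 0
  then show ?case
    using mdiam_le_neighbour[of B k A] assms by auto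
next
  case (Suc N)
  then obtain z D where "(x, z) \<in> same_tile X k ^^ N" "D \<in> X k" "z \<in> D" "y \<in> D"
    by (auto simp: same_tile_def)
  then have "mdiam d D \<le> C ^ Suc N * mdiam d A" "mdiam d B \<le> C * mdiam d D"
    using Suc mdiam_le_neighbour[of B k D] by auto
  then have "mdiam d B \<le> C * (C ^ Suc N * mdiam d A)"
    using C_ge_1 by (smt (verit) mult_left_mono)
  then show ?case
    by (simp add: ac_simps)
qed

lemma chain_dist_le:
  assumes "(x, y) \<in> same_tile X k ^^ N" "x \<in> A" "A \<in> X k"
  shows "d x y \<le> real N * C ^ N * mdiam d A"
  using assms(1)
proof (induction N arbitrary: y)
  case 0
  moreover have "x \<in> S"
    using assms tile_subset by blast
  ultimately show ?case
    by simp
next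
  case (Suc N)
  then obtain z D where z: "(x, z) \<in> same_tile X k ^^ N" "D \<in> X k" "z \<in> D" "y \<in> D"
    by (auto simp: same_tile_def)
  have "x \<in> S" "y \<in> S" "z \<in> S"
    using z assms tile_subset by blast+
  then have "d x y \<le> d x z + d z y"
    by (intro triangle) auto
  also have "d x z \<le> real N * C ^ N * mdiam d A"
    using Suc.IH z by blast
  also have "d z y \<le> C ^ Suc N * mdiam d A"
    using dist_le_tile[of D k z y] chain_mdiam_le[OF z(1) assms(2,3) z(3,2)] z by linarith
  also have "real N * C ^ N * mdiam d A \<le> real N * C ^ Suc N * mdiam d A"
    using C_ge_1 mdiam_nonneg[OF assms(3)]
    by (intro mult_right_mono mult_left_mono power_increasing) auto
  finally show ?case
    by (simp add: algebra_simps)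
qed

text \<open>Tiles through \<open>x\<close> and \<open>y\<close> are too close to each other to have disjoint \<open>w\<close>-neighbourhoods, and
  a common point of the neighbourhoods is reached from either side with \<open>w + 1\<close> steps.\<close>

lemma chain_if_dist_less:
  assumes "x \<in> A" "A \<in> X k" "y \<in> S" "C * d x y < mdiam d A"
  shows "(x, y) \<in> same_tile X k ^^ (2 * w + 2)"
proof -
  obtain B where B: "B \<in> X k" "y \<in> B"
    using tile_through assms by blast
  have "C * msetdist d A B \<le> C * d x y"
    using msetdist_le_dist[of x A y B] assms B C_ge_1 by (intro mult_left_mono) auto
  then have "tile_nbhd (X k) w A \<inter> tile_nbhd (X k) w B \<noteq> {}"
    using mdiam_le_msetdist[of A k B] assms B by auto
  then obtain z A' B' i j where z: "z \<in> A'" "z \<in> B'"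
    and i: "i \<le> w" "tile_chain (X k) i A A'" and j: "j \<le> w" "tile_chain (X k) j B B'"
    by (auto simp: tile_nbhd_def)
  have "x \<in> S"
    using assms tile_subset by blast
  have "(x, z) \<in> same_tile X k ^^ Suc i"
    using tile_chain_imp_same_tile_relpow[of X k i A A' x z] assms(1) z i by blast
  then have "(x, z) \<in> same_tile X k ^^ (w + 1)"
    by (rule same_tile_relpow_mono) (use i \<open>x \<in> S\<close> in auto)
  moreover have "(y, z) \<in> same_tile X k ^^ Suc j"
    using tile_chain_imp_same_tile_relpow[of X k j B B' y z] B z j by blast
  then have "(y, z) \<in> same_tile X k ^^ (w + 1)"
    by (rule same_tile_relpow_mono) (use j assms(3) in auto)
  ultimately have "(x, y) \<in> same_tile X k ^^ (w + 1 + (w + 1))"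
    using relpow_trans same_tile_relpow_sym by metis
  then show ?thesis
    by (simp add: mult_2)
qed

lemma chains_are_short:
  assumes "0 < e"
  obtains k where "\<And>x y. x \<in> S \<Longrightarrow> (x, y) \<in> same_tile X k ^^ N \<Longrightarrow> d x y < e"
proof -
  have S0: "S \<in> X 0"
    by (simp add: level_zero)
  define c where "c = real N * C ^ N * (K * mdiam d S)"
  have bound: "d x y \<le> c * rho ^ k" if xy: "x \<in> S" "(x, y) \<in> same_tile X k ^^ N" for x y k
  proof -
    obtain A where A: "A \<in> X k" "x \<in> A"
      using tile_through xy by blast
    have "d x y \<le> real N * C ^ N * mdiam d A"
      using chain_dist_le xy A by blast
    also have "\<dots> \<le> real N * C ^ N * (K * rho ^ k * mdiam d S)"
      using mdiam_decay[of x S A 0 k] A xy S0 C_ge_1 by (intro mult_left_mono) auto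
    finally show ?thesis
      by (simp add: c_def ac_simps)
  qed
  have "(\<lambda>k. c * rho ^ k) \<longlonglongrightarrow> c * 0"
    using rho_pos rho_less_1 by (intro tendsto_intros LIMSEQ_power_zero) auto
  then have "\<forall>\<^sub>F k in sequentially. c * rho ^ k < e"
    using assms by (simp add: order_tendstoD(2))
  then obtain k where "c * rho ^ k < e"
    by (meson eventually_happens' sequentially_bot)
  then show thesis
    using bound by (intro that[of k]) (meson le_less_trans)
qed

lemma eq_if_all_chains:
  assumes "x \<in> S" "\<And>k. (x, y) \<in> same_tile X k ^^ N"
  shows "x = y"
proof (rule ccontr)
  assume "x \<noteq> y"
  then have "0 < d x y"
    using assms relpow_in_S mdist_pos_less by blast
  then obtain k where "\<And>a b. a \<in> S \<Longrightarrow> (a, b) \<in> same_tile X k ^^ N \<Longrightarrow> d a b < d x y"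
    using chains_are_short by blast
  then show False
    using assms by blast
qed

section \<open>Chains and the tile graph\<close>

text \<open>Adjacency in the tile graph with loops added. Walks may then pause, so that their lengths need
  only be estimated from above.\<close>

definition tile_step :: "((nat \<times> 'a set) \<times> (nat \<times> 'a set)) set" where
  "tile_step = {(u, v). u \<in> tiles X \<and> v \<in> tiles X \<and> snd u \<inter> snd v \<noteq> {} \<and>
     \<bar>int (fst u) - int (fst v)\<bar> \<le> 1}"

lemma tile_edges_eq: "tile_edges X = tile_step - Id"
  by (auto simp: tile_edges_def tile_step_def)

lemma tile_step_relpow_sym: "(u, v) \<in> tile_step ^^ n \<Longrightarrow> (v, u) \<in> tile_step ^^ n"
proof (induction n arbitrary: v)
  case (Suc n)
  then obtain z where "(u, z) \<in> tile_step ^^ n" "(z, v) \<in> tile_step"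
    by auto
  with Suc.IH have "(z, u) \<in> tile_step ^^ n" "(v, z) \<in> tile_step"
    by (auto simp: tile_step_def)
  then show ?case
    by (meson relpow_Suc_I2)
qed auto

lemma tile_step_relpow_imp_edges:
  "(u, v) \<in> tile_step ^^ n \<Longrightarrow> \<exists>m\<le>n. (u, v) \<in> tile_edges X ^^ m"
proof (induction n arbitrary: v)
  case (Suc n)
  then obtain z where z: "(u, z) \<in> tile_step ^^ n" "(z, v) \<in> tile_step"
    by auto
  then obtain m where m: "m \<le> n" "(u, z) \<in> tile_edges X ^^ m"
    using Suc.IH by blast
  show ?case
  proof (cases "z = v")
    case True
    then show ?thesis
      using m le_SucI by blast
  next
    case False
    then have "(u, v) \<in> tile_edges X ^^ Suc m"
      using m z by (auto simp: tile_edges_eq)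
    then show ?thesis
      using m by blast
  qed
qed auto

lemma tile_gdist_le: "(u, v) \<in> tile_step ^^ n \<Longrightarrow> tile_gdist X u v \<le> n"
  unfolding tile_gdist_def by (metis Least_le order_trans tile_step_relpow_imp_edges)

lemma vertical_walk:
  assumes "x \<in> A" "A \<in> X n" "x \<in> B" "B \<in> X (n + j)"
  shows "((n, A), (n + j, B)) \<in> tile_step ^^ Suc j"
  using assms(3,4)
proof (induction j arbitrary: B)
  case 0
  then show ?case
    using assms by (auto simp: tile_step_def tiles_def)
next
  case (Suc j)
  then obtain D where D: "D \<in> X (n + j)" "x \<in> D"
    using tile_through assms tile_subset by blast
  then have "((n, A), (n + j, D)) \<in> tile_step ^^ Suc j"
    using Suc.IH by blast
  moreover have "((n + j, D), (n + Suc j, B)) \<in> tile_step"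
    using D Suc.prems by (auto simp: tile_step_def tiles_def)
  ultimately show ?case
    by (meson relpow_Suc_I)
qed

lemma horizontal_walk:
  assumes "(x, y) \<in> same_tile X k ^^ N" "x \<in> A" "A \<in> X k" "y \<in> B" "B \<in> X k"
  shows "((k, A), (k, B)) \<in> tile_step ^^ Suc N"
  using assms(1,4,5)
proof (induction N arbitrary: y B)
  case 0
  then show ?case
    using assms by (auto simp: tile_step_def tiles_def)
next
  case (Suc N)
  then obtain z D where D: "(x, z) \<in> same_tile X k ^^ N" "D \<in> X k" "z \<in> D" "y \<in> D"
    by (auto simp: same_tile_def)
  then have "((k, A), (k, D)) \<in> tile_step ^^ Suc N"
    using Suc.IH by blast
  moreover have "((k, D), (k, B)) \<in> tile_step"
    using D Suc.prems by (auto simp: tile_step_def tiles_def)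
  ultimately show ?case
    by (meson relpow_Suc_I)
qed

text \<open>The walk descends from the first tile to level \<open>k\<close>, follows the chain and ascends to the second
  tile.\<close>

lemma walk_of_chain:
  assumes "x \<in> A" "A \<in> X (k + i)" "y \<in> B" "B \<in> X (k + j)" "(x, y) \<in> same_tile X k ^^ N"
  shows "((k + i, A), (k + j, B)) \<in> tile_step ^^ (i + j + N + 3)"
proof -
  obtain P where P: "P \<in> X k" "x \<in> P"
    using tile_through assms tile_subset by blast
  obtain Q where Q: "Q \<in> X k" "y \<in> Q"
    using tile_through assms tile_subset by blast
  have "((k + i, A), (k, P)) \<in> tile_step ^^ Suc i"
    using vertical_walk[of x P k A i] P assms by (auto intro!: tile_step_relpow_sym[of "(k, P)"] simp del: relpow.simps)
  from relpow_trans[OF relpow_trans[OF this horizontal_walk[OF assms(5) P(2,1) Q(2,1)]]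
      vertical_walk[OF Q(2,1) assms(3,4)]]
  show ?thesis
    by (simp add: eval_nat_numeral ac_simps)
qed

lemma tile_gdist_walk:
  assumes "u \<in> tiles X" "v \<in> tiles X"
  shows "(u, v) \<in> tile_edges X ^^ tile_gdist X u v"
proof -
  obtain n A m B where uv: "u = (n, A)" "v = (m, B)" "A \<in> X n" "B \<in> X m"
    using assms by (cases u; cases v) (auto simp: tiles_def)
  obtain x y where xy: "x \<in> A" "y \<in> B"
    using nonempty uv by blast
  then have "(x, y) \<in> same_tile X 0 ^^ 1"
    using tile_subset[OF uv(3)] tile_subset[OF uv(4)] level_zero by (auto simp: same_tile_def)
  then have "(u, v) \<in> tile_step ^^ (n + m + 1 + 3)"
    using walk_of_chain[of x A 0 n y B m 1] uv xy by simp
  then show ?thesis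
    unfolding tile_gdist_def by (metis LeastI tile_step_relpow_imp_edges)
qed

lemma tile_gdist_sym: "u \<in> tiles X \<Longrightarrow> v \<in> tiles X \<Longrightarrow> tile_gdist X u v = tile_gdist X v u"
proof -
  have "tile_gdist X u v \<le> tile_gdist X v u" if "u \<in> tiles X" "v \<in> tiles X" for u v
  proof -
    have "(v, u) \<in> tile_step ^^ tile_gdist X v u"
      using tile_gdist_walk[OF that(2,1)] unfolding relpow_fun_conv tile_edges_eq by blast
    then show ?thesis
      by (rule tile_gdist_le[OF tile_step_relpow_sym])
  qed
  then show "u \<in> tiles X \<Longrightarrow> v \<in> tiles X \<Longrightarrow> ?thesis"
    by (simp add: antisym)
qed

lemma gromov_product_sym:
  "u \<in> tiles X \<Longrightarrow> v \<in> tiles X \<Longrightarrow> gromov_product X u v = gromov_product X v u"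
  by (simp add: gromov_product_def tile_gdist_sym)

lemma gromov_product_ge:
  assumes "u \<in> tiles X" "v \<in> tiles X" "x \<in> snd u" "y \<in> snd v" "k \<le> fst u" "k \<le> fst v"
    and "(x, y) \<in> same_tile X k ^^ N"
  shows "real k - (real N + 3) / 2 \<le> gromov_product X u v"
proof -
  obtain i j where ij: "fst u = k + i" "fst v = k + j"
    using assms(5,6) le_Suc_ex by metis
  then have "(u, v) \<in> tile_step ^^ (i + j + N + 3)"
    using walk_of_chain[of x "snd u" k i y "snd v" j N] assms
    by (cases u; cases v) (auto simp: tiles_def)
  then have "real (tile_gdist X u v) \<le> real (i + j + N + 3)"
    using tile_gdist_le of_nat_le_iff by blast
  then show ?thesis
    by (simp add: gromov_product_def ij field_simps)
qed

lemma tile_edges_level: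
  "(u, v) \<in> tile_edges X \<Longrightarrow> fst v \<le> fst u + 1 \<and> fst u \<le> fst v + 1"
  by (auto simp: tile_edges_def)

lemma walk_level:
  assumes "\<And>i. i < L \<Longrightarrow> (f i, f (Suc i)) \<in> tile_edges X" "i \<le> j" "j \<le> L"
  shows "fst (f i) \<le> fst (f j) + (j - i) \<and> fst (f j) \<le> fst (f i) + (j - i)"
  using assms(2,3)
proof (induction j rule: dec_induct)
  case (step l)
  then show ?case
    using tile_edges_level[OF assms(1)[of l]] by linarith
qed simp

lemma gromov_product_le_level:
  assumes "u \<in> tiles X" "v \<in> tiles X"
  shows "gromov_product X u v \<le> fst u" "gromov_product X u v \<le> fst v"
proof -
  obtain f where "f 0 = u" "f (tile_gdist X u v) = v"
    "\<And>i. i < tile_gdist X u v \<Longrightarrow> (f i, f (Suc i)) \<in> tile_edges X"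
    using tile_gdist_walk[OF assms] unfolding relpow_fun_conv by blast
  then have "fst u \<le> fst v + tile_gdist X u v" "fst v \<le> fst u + tile_gdist X u v"
    using walk_level[of "tile_gdist X u v" f 0 "tile_gdist X u v"] by auto
  then show "gromov_product X u v \<le> fst u" "gromov_product X u v \<le> fst v"
    by (auto simp: gromov_product_def)
qed

text \<open>A walk whose level after \<open>i\<close> steps is at least \<open>k + r + i\<close> stays close to its start. The diameters of
  its tiles should form a geometric series, but the decay estimate compares such a tile only with
  a \<open>k\<close>-tile \<open>Q\<close> that it meets, not with a fixed \<open>k\<close>-tile \<open>P\<close> at the start. The two are comparable as
  long as the walk has not left a small neighbourhood of the start, and for large \<open>r\<close> the series is so
  small that this is never the case: both facts are carried along the walk together.\<close>

lemma ascending_walk_chain: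
  fixes r :: nat
  defines "kap \<equiv> K * rho ^ r * C ^ (2 * w + 3)"
  assumes small: "C * (kap / (1 - rho)) < 1"
    and walk: "\<And>i. i < t \<Longrightarrow> snd (f i) \<inter> snd (f (Suc i)) \<noteq> {}"
    and tile: "\<And>i. i \<le> t \<Longrightarrow> snd (f i) \<in> X (fst (f i))"
    and level: "\<And>i. i \<le> t \<Longrightarrow> k + r + i \<le> fst (f i)"
    and x: "x \<in> snd (f 0)" and y: "y \<in> snd (f t)"
  shows "(x, y) \<in> same_tile X k ^^ (2 * w + 2)"
proof -
  have "x \<in> S"
    using tile[of 0] x tile_subset by blast
  then obtain P where P: "P \<in> X k" "x \<in> P"
    using tile_through by blast
  note P_pos = mdiam_pos[OF P(1)]
  have kap_pos: "0 < kap"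
    using K_ge_1 rho_pos C_ge_1 by (simp add: kap_def)
  have close: "(x, z) \<in> same_tile X k ^^ (2 * w + 2)"
    if "d x z \<le> kap / (1 - rho) * (1 - rho ^ Suc i) * mdiam d P" "z \<in> S" for z i
  proof (rule chain_if_dist_less[OF P(2,1) that(2)])
    have "C * (kap / (1 - rho)) * (1 - rho ^ Suc i) \<le> C * (kap / (1 - rho)) * 1"
      using kap_pos C_ge_1 rho_pos rho_less_1 by (intro mult_left_mono) auto
    then have "C * (kap / (1 - rho)) * (1 - rho ^ Suc i) < 1"
      using small by simp
    then have "C * (kap / (1 - rho)) * (1 - rho ^ Suc i) * mdiam d P < 1 * mdiam d P"
      using P_pos by (rule mult_strict_right_mono)
    moreover have "C * d x z \<le> C * (kap / (1 - rho) * (1 - rho ^ Suc i) * mdiam d P)"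
      using that C_ge_1 by (intro mult_left_mono) auto
    ultimately show "C * d x z < mdiam d P"
      by (simp add: ac_simps)
  qed
  have tile_small: "mdiam d (snd (f i)) \<le> kap * rho ^ i * mdiam d P"
    if i: "i \<le> t" and z: "z \<in> snd (f i)" and xz: "(x, z) \<in> same_tile X k ^^ (2 * w + 2)" for i z
  proof -
    have "k \<le> fst (f i)"
      using level[OF i] by linarith
    then obtain l where l: "fst (f i) = k + l"
      using le_Suc_ex by blast
    have "r + i \<le> l"
      using level[OF i] l by linarith
    obtain Q where Q: "Q \<in> X k" "z \<in> Q"
      using tile_through tile[OF i] z tile_subset by blast
    have "mdiam d (snd (f i)) \<le> K * rho ^ l * mdiam d Q"
      using mdiam_decay[of z Q "snd (f i)" k l] Q z tile[OF i] l by auto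
    also have "\<dots> \<le> K * rho ^ (r + i) * (C ^ Suc (2 * w + 2) * mdiam d P)"
      using chain_mdiam_le[OF xz P(2,1) Q(2,1)] \<open>r + i \<le> l\<close> rho_pos rho_less_1 K_ge_1
        mdiam_nonneg[OF Q(1)]
      by (intro mult_mono mult_left_mono power_decreasing) auto
    also have "\<dots> = kap * rho ^ i * mdiam d P"
      by (simp add: kap_def power_add eval_nat_numeral)
    finally show ?thesis .
  qed
  \<comment> \<open>The right-hand side is the sum of the diameter bounds of the first \<open>i + 1\<close> tiles.\<close>
  have "d x z \<le> kap / (1 - rho) * (1 - rho ^ Suc i) * mdiam d P" if "i \<le> t" "z \<in> snd (f i)" for i z
    using that
  proof (induction i arbitrary: z)
    case 0
    have "(x, x) \<in> same_tile X k ^^ (2 * w + 2)"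
      using \<open>x \<in> S\<close> by (rule same_tile_relpow_refl)
    then have "mdiam d (snd (f 0)) \<le> kap * rho ^ 0 * mdiam d P"
      using tile_small[of 0 x] x by simp
    then show ?case
      using dist_le_tile[OF tile[of 0] x 0(2)] rho_less_1 by simp
  next
    case (Suc i)
    obtain q where q: "q \<in> snd (f i)" "q \<in> snd (f (Suc i))"
      using walk[of i] Suc.prems by auto
    have S: "q \<in> S" "z \<in> S"
      using q Suc.prems tile tile_subset by blast+
    have xq: "d x q \<le> kap / (1 - rho) * (1 - rho ^ Suc i) * mdiam d P"
      using Suc q by simp
    have "mdiam d (snd (f (Suc i))) \<le> kap * rho ^ Suc i * mdiam d P"
      using tile_small[OF Suc.prems(1) q(2) close[OF xq S(1)]] .
    then have "d q z \<le> kap * rho ^ Suc i * mdiam d P"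
      using dist_le_tile[OF tile[OF Suc.prems(1)] q(2) Suc.prems(2)] by linarith
    then have "d x z \<le> kap / (1 - rho) * (1 - rho ^ Suc i) * mdiam d P + kap * rho ^ Suc i * mdiam d P"
      using xq triangle[OF \<open>x \<in> S\<close> S] by linarith
    also have "\<dots> = kap / (1 - rho) * (1 - rho ^ Suc (Suc i)) * mdiam d P"
      using rho_less_1 by (simp add: field_simps)
    finally show ?case .
  qed
  then show ?thesis
    using close y tile[of t] tile_subset by blast
qed

text \<open>Let \<open>p = k + r\<close>. The length \<open>L\<close> of a geodesic from \<open>u\<close> to \<open>v\<close> is at most
  \<open>fst u + fst v - 2 * p\<close>. The level changes by at most one per step, so after \<open>fst u - p\<close> steps (or
  at \<open>v\<close>, if the geodesic is shorter) one is at a vertex such that \<open>i\<close> steps away from it, in either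
  direction, the level is at least \<open>p + i\<close>.\<close>

lemma gromov_product_imp_chain:
  obtains r where "\<And>u v x y k. u \<in> tiles X \<Longrightarrow> v \<in> tiles X \<Longrightarrow> x \<in> snd u \<Longrightarrow> y \<in> snd v \<Longrightarrow>
    real (k + r) \<le> gromov_product X u v \<Longrightarrow> (x, y) \<in> same_tile X k ^^ (4 * w + 4)"
proof -
  \<comment> \<open>The shift \<open>r\<close> is taken so large that the geometric series stays below the threshold \<open>1 / C\<close>.\<close>
  define M where "M = C * (K * C ^ (2 * w + 3) / (1 - rho))"
  have "0 < M"
    using C_ge_1 K_ge_1 rho_less_1 by (simp add: M_def)
  then obtain r where "rho ^ r < 1 / M"
    using real_arch_pow_inv[of "1 / M" rho] rho_less_1 by auto
  then have "rho ^ r * M < 1"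
    using \<open>0 < M\<close> by (simp add: field_simps)
  then have r: "C * (K * rho ^ r * C ^ (2 * w + 3) / (1 - rho)) < 1"
    by (simp add: M_def ac_simps)
  show thesis
  proof (rule that)
    fix u v x y k
    assume uv: "u \<in> tiles X" "v \<in> tiles X" and xy: "x \<in> snd u" "y \<in> snd v"
      and prod: "real (k + r) \<le> gromov_product X u v"
    define L where "L = tile_gdist X u v"
    define p where "p = k + r"
    have "2 * real p + real L \<le> real (fst u) + real (fst v)"
      using prod by (simp add: gromov_product_def L_def p_def)
    then have p: "2 * p + L \<le> fst u + fst v"
      by linarith
    obtain f where f: "f 0 = u" "f L = v" "\<And>i. i < L \<Longrightarrow> (f i, f (Suc i)) \<in> tile_edges X"
      using tile_gdist_walk[OF uv] unfolding relpow_fun_conv L_def by blast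
    have tile: "snd (f i) \<in> X (fst (f i))" if "i \<le> L" for i
      using f(3)[of i] f(2) uv that
      by (cases "i = L") (auto simp: tiles_def tile_edges_def mem_Times_iff)
    have meet: "snd (f i) \<inter> snd (f (Suc i)) \<noteq> {}" if "i < L" for i
      using f(3)[OF that] by (auto simp: tile_edges_def)
    have levels: "fst u \<le> fst (f i) + i" "fst v \<le> fst (f i) + (L - i)" if "i \<le> L" for i
      using walk_level[of L f 0 i] walk_level[of L f i L] f that by auto
    define j where "j = min (fst u - p) L"
    have j: "j \<le> L" "j \<le> fst u - p"
      by (simp_all add: j_def)
    have "p \<le> fst u" "p \<le> fst v"
      using levels(2)[of 0] levels(1)[of L] p f(1,2) by simp_all
    then have Lp: "L + p \<le> fst v + j"
      using p by (cases "fst u - p \<le> L") (simp_all add: j_def)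
    obtain z where z: "z \<in> snd (f j)"
      using nonempty tile[OF j(1)] by blast
    have "(z, x) \<in> same_tile X k ^^ (2 * w + 2)"
    proof (rule ascending_walk_chain[OF r, of j "\<lambda>i. f (j - i)"])
      show "snd (f (j - i)) \<inter> snd (f (j - Suc i)) \<noteq> {}" if "i < j" for i
        using meet[of "j - Suc i"] that j by (simp add: Suc_diff_Suc Int_commute)
      show "k + r + i \<le> fst (f (j - i))" if "i \<le> j" for i
      proof -
        have "fst u \<le> fst (f (j - i)) + (j - i)"
          using levels(1) j by simp
        then show ?thesis
          using that j \<open>p \<le> fst u\<close> unfolding p_def by linarith
      qed
    qed (use tile j z xy f in auto)
    moreover have "(z, y) \<in> same_tile X k ^^ (2 * w + 2)"
    proof (rule ascending_walk_chain[OF r, of "L - j" "\<lambda>i. f (j + i)"])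
      show "k + r + i \<le> fst (f (j + i))" if "i \<le> L - j" for i
      proof -
        have "fst v \<le> fst (f (j + i)) + (L - (j + i))"
          using levels(2) that j by simp
        then show ?thesis
          using that j Lp unfolding p_def by linarith
      qed
    qed (use tile meet j z xy f in auto)
    ultimately have "(x, y) \<in> same_tile X k ^^ (2 * w + 2 + (2 * w + 2))"
  using relpow_trans same_tile_relpow_sym by metis
    moreover have "2 * w + 2 + (2 * w + 2) = 4 * w + 4"
      by simp
    ultimately show "(x, y) \<in> same_tile X k ^^ (4 * w + 4)"
      by (simp only:)
  qed
qed

section \<open>The boundary at infinity\<close>

lemma filterlim_at_top_nat_bound:
  fixes f :: "'i \<Rightarrow> real"
  shows "filterlim f at_top F \<longleftrightarrow> (\<forall>p::nat. eventually (\<lambda>i. real p \<le> f i) F)"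
  unfolding filterlim_at_top
  by (metis (mono_tags, lifting) eventually_mono order_trans real_arch_simple)

text \<open>The points \<open>x i\<close> and \<open>y i\<close> picked from the tiles are arbitrary. The filter is kept general in
  order to cover double sequences, as in the definition of convergence at infinity.\<close>

lemma chain_if_gromov_product_to_infinity:
  assumes "filterlim (\<lambda>i. gromov_product X (s i) (t i)) at_top F"
    and "\<And>i. s i \<in> tiles X" "\<And>i. t i \<in> tiles X"
    and "\<And>i. x i \<in> snd (s i)" "\<And>i. y i \<in> snd (t i)"
  shows "eventually (\<lambda>i. (x i, y i) \<in> same_tile X k ^^ (4 * w + 4) \<and>
    k \<le> fst (s i) \<and> k \<le> fst (t i)) F"
proof -
  obtain r where r: "\<And>u v x y k. u \<in> tiles X \<Longrightarrow> v \<in> tiles X \<Longrightarrow> x \<in> snd u \<Longrightarrow> y \<in> snd v \<Longrightarrow>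
    real (k + r) \<le> gromov_product X u v \<Longrightarrow> (x, y) \<in> same_tile X k ^^ (4 * w + 4)"
    using gromov_product_imp_chain by blast
  have "eventually (\<lambda>i. real (k + r) \<le> gromov_product X (s i) (t i)) F"
    using assms(1) unfolding filterlim_at_top_nat_bound by blast
  then show ?thesis
  proof eventually_elim
    case (elim i)
    have "real (k + r) \<le> real (fst (s i))" "real (k + r) \<le> real (fst (t i))"
      using elim gromov_product_le_level[OF assms(2)[of i] assms(3)[of i]] by linarith+
    then show ?case
      using r[OF assms(2-5) elim] by simp
  qed
qed

lemma gromov_product_to_infinity_if_chain:
  assumes "\<And>k. eventually (\<lambda>i. (x i, y i) \<in> same_tile X k ^^ N \<and> k \<le> fst (s i) \<and> k \<le> fst (t i)) F"
    and "\<And>i. s i \<in> tiles X" "\<And>i. t i \<in> tiles X"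
    and "\<And>i. x i \<in> snd (s i)" "\<And>i. y i \<in> snd (t i)"
  shows "filterlim (\<lambda>i. gromov_product X (s i) (t i)) at_top F"
  unfolding filterlim_at_top_nat_bound
proof
  fix p :: nat
  show "eventually (\<lambda>i. real p \<le> gromov_product X (s i) (t i)) F"
    using assms(1)[of "p + N + 3"]
  proof eventually_elim
    case (elim i)
    then have "real (p + N + 3) - (real N + 3) / 2 \<le> gromov_product X (s i) (t i)"
      using gromov_product_ge[OF assms(2-5)] by blast
    then show ?case
      by (simp add: field_simps)
  qed
qed

lemma converges_at_infinity_diagonal:
  assumes "converges_at_infinity X s"
  shows "filterlim (\<lambda>i. gromov_product X (s i) (s i)) at_top sequentially"
proof -
  have diag: "filterlim (\<lambda>i::nat. (i, i)) (sequentially \<times>\<^sub>F sequentially) sequentially"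
    by (rule filterlim_Pair[OF filterlim_ident filterlim_ident])
  have "filterlim (\<lambda>(i, j). gromov_product X (s i) (s j)) at_top (sequentially \<times>\<^sub>F sequentially)"
    using assms by (simp add: converges_at_infinity_def)
  from filterlim_compose[OF this diag] show ?thesis
    by simp
qed

lemma converges_at_infinity_tiles: "converges_at_infinity X s \<Longrightarrow> s i \<in> tiles X"
  by (auto simp: converges_at_infinity_def)

lemma tiles_iff: "u \<in> tiles X \<longleftrightarrow> snd u \<in> X (fst u)"
  by (cases u) (simp add: tiles_def)

lemma obtain_points_of_tiles:
  assumes "\<And>i. s i \<in> tiles X"
  obtains x where "\<And>i. x i \<in> snd (s i)"
proof -
  have "\<exists>x. x \<in> snd (s i)" for i
    using assms[of i] nonempty unfolding tiles_iff by blast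
  then obtain x where x: "\<And>i. x i \<in> snd (s i)"
    by metis
  then show thesis
    by (rule that)
qed

text \<open>Transitivity is the place where hyperbolicity enters, in the form that chains of bounded length
  at one level can be concatenated.\<close>

lemma equiv_infinity_rel: "equiv {s. converges_at_infinity X s} (infinity_rel X)"
proof (rule equivI)
  show "infinity_rel X \<subseteq> {s. converges_at_infinity X s} \<times> {s. converges_at_infinity X s}"
    by (auto simp: infinity_rel_def)
  show "refl_on {s. converges_at_infinity X s} (infinity_rel X)"
    by (auto simp: refl_on_def infinity_rel_def converges_at_infinity_diagonal)
  show "sym (infinity_rel X)"
    by (auto simp: sym_def infinity_rel_def gromov_product_sym converges_at_infinity_tiles)
  show "trans (infinity_rel X)"
  proof (rule transI)
    fix s t q
    assume "(s, t) \<in> infinity_rel X" "(t, q) \<in> infinity_rel X"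
    then have conv: "converges_at_infinity X s" "converges_at_infinity X t" "converges_at_infinity X q"
      and st: "filterlim (\<lambda>i. gromov_product X (s i) (t i)) at_top sequentially"
      and tq: "filterlim (\<lambda>i. gromov_product X (t i) (q i)) at_top sequentially"
      by (auto simp: infinity_rel_def)
    note tiles = conv[THEN converges_at_infinity_tiles]
    obtain x where x: "\<And>i. x i \<in> snd (s i)"
      using obtain_points_of_tiles tiles(1) by metis
    obtain y where y: "\<And>i. y i \<in> snd (t i)"
      using obtain_points_of_tiles tiles(2) by metis
    obtain z where z: "\<And>i. z i \<in> snd (q i)"
      using obtain_points_of_tiles tiles(3) by metis
    have "filterlim (\<lambda>i. gromov_product X (s i) (q i)) at_top sequentially"
    proof (rule gromov_product_to_infinity_if_chain[OF _ tiles(1,3) x z])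
      fix k
      show "\<forall>\<^sub>F i in sequentially. (x i, z i) \<in> same_tile X k ^^ (4 * w + 4 + (4 * w + 4)) \<and>
          k \<le> fst (s i) \<and> k \<le> fst (q i)"
        using chain_if_gromov_product_to_infinity[OF st tiles(1,2) x y, of k]
          chain_if_gromov_product_to_infinity[OF tq tiles(2,3) y z, of k]
        by eventually_elim (use relpow_trans in metis)
    qed
    then show "(s, q) \<in> infinity_rel X"
      using conv by (simp add: infinity_rel_def)
  qed
qed

section \<open>The natural identification is a bijection\<close>

lemma natural_geodesic_exists: "x \<in> S \<Longrightarrow> \<exists>g. natural_geodesic X x g"
proof -
  assume "x \<in> S"
  then have "\<forall>n. \<exists>A. A \<in> X n \<and> x \<in> A"
    using tile_through by metis
  then obtain A where "\<And>n. A n \<in> X n \<and> x \<in> A n"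
    by metis
  then have "natural_geodesic X x (\<lambda>n. (n, A n))"
    by (simp add: natural_geodesic_def)
  then show ?thesis
    by blast
qed

lemma natural_geodesicD:
  assumes "natural_geodesic X x g"
  shows "g i \<in> tiles X" "x \<in> snd (g i)" "fst (g i) = i" "snd (g i) \<in> X i" "x \<in> S"
  using assms tile_subset[of "snd (g 0)" 0]
  by (auto simp: natural_geodesic_def tiles_iff)

lemma natural_geodesic_converges:
  assumes "natural_geodesic X x g"
  shows "converges_at_infinity X g"
proof -
  note g = natural_geodesicD[OF assms]
  have "filterlim (\<lambda>p. gromov_product X (g (fst p)) (g (snd p))) at_top (sequentially \<times>\<^sub>F sequentially)"
  proof (rule gromov_product_to_infinity_if_chain[where x = "\<lambda>_. x" and y = "\<lambda>_. x" and N = 0])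
    fix k
    show "\<forall>\<^sub>F p in sequentially \<times>\<^sub>F sequentially.
      (x, x) \<in> same_tile X k ^^ 0 \<and> k \<le> fst (g (fst p)) \<and> k \<le> fst (g (snd p))"
      unfolding eventually_prod_sequentially by (auto simp: g intro!: exI[of _ k])
  qed (simp_all add: g)
  then show ?thesis
    using g(1) by (auto simp: converges_at_infinity_def case_prod_unfold)
qed

text \<open>Chains of a fixed length at each level suffice, since the levels of the tiles of \<open>s\<close> tend to infinity: the
  Gromov product of a vertex with itself is its level.\<close>

lemma infinity_rel_geodesicI:
  assumes g: "natural_geodesic X x g" and s: "converges_at_infinity X s" "\<And>i. y i \<in> snd (s i)"
    and chain: "\<And>k. eventually (\<lambda>i. (x, y i) \<in> same_tile X k ^^ N) sequentially"
  shows "(g, s) \<in> infinity_rel X"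
proof -
  note g' = natural_geodesicD[OF g]
  note tiles = converges_at_infinity_tiles[OF s(1)]
  have "filterlim (\<lambda>i. gromov_product X (g i) (s i)) at_top sequentially"
  proof (rule gromov_product_to_infinity_if_chain[OF _ g'(1) tiles g'(2) s(2)])
    fix k
    show "\<forall>\<^sub>F i in sequentially. (x, y i) \<in> same_tile X k ^^ N \<and> k \<le> fst (g i) \<and> k \<le> fst (s i)"
      using chain[of k] eventually_ge_at_top[of k]
        chain_if_gromov_product_to_infinity[OF converges_at_infinity_diagonal[OF s(1)] tiles tiles s(2) s(2), of k]
      by eventually_elim (simp add: g')
  qed
  then show ?thesis
    using natural_geodesic_converges[OF g] s(1) by (simp add: infinity_rel_def)
qed

lemma natural_identification_eq:
  assumes g: "natural_geodesic X x g"
  shows "natural_identification X x = infinity_rel X `` {g}"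
  unfolding natural_identification_def
proof (rule the_equality)
  show "\<exists>h. natural_geodesic X x h \<and> infinity_rel X `` {g} = infinity_rel X `` {h}"
    using g by blast
next
  fix P
  assume "\<exists>h. natural_geodesic X x h \<and> P = infinity_rel X `` {h}"
  then obtain h where h: "natural_geodesic X x h" "P = infinity_rel X `` {h}"
    by blast
  have "(g, h) \<in> infinity_rel X"
    by (rule infinity_rel_geodesicI[OF g natural_geodesic_converges[OF h(1)], where y = "\<lambda>_. x" and N = 0])
      (simp_all add: natural_geodesicD[OF h(1)])
  then show "P = infinity_rel X `` {g}"
    using equiv_class_eq[OF equiv_infinity_rel] h(2) by metis
qed

text \<open>If two natural geodesics are equivalent, their base points are chained at every level, by chains
  of a fixed length, whereas such chains shrink to points.\<close>

lemma natural_identification_inj: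
  assumes "x \<in> S" "y \<in> S" "natural_identification X x = natural_identification X y"
  shows "x = y"
proof -
  obtain g h where gh: "natural_geodesic X x g" "natural_geodesic X y h"
    using natural_geodesic_exists assms by metis
  then have "(g, h) \<in> infinity_rel X"
    using assms(3) natural_identification_eq natural_geodesic_converges
      eq_equiv_class[OF _ equiv_infinity_rel, of g h] by (metis mem_Collect_eq)
  then have "filterlim (\<lambda>i. gromov_product X (g i) (h i)) at_top sequentially"
    by (simp add: infinity_rel_def)
  then have "\<forall>\<^sub>F i in sequentially. (x, y) \<in> same_tile X k ^^ (4 * w + 4) \<and> k \<le> fst (g i) \<and> k \<le> fst (h i)" for k
    by (rule chain_if_gromov_product_to_infinity)
      (simp_all add: natural_geodesicD[OF gh(1)] natural_geodesicD[OF gh(2)])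
  then have "(x, y) \<in> same_tile X k ^^ (4 * w + 4)" for k
    using eventually_happens'[OF sequentially_bot] by (metis (mono_tags, lifting))
  then show ?thesis
    using eq_if_all_chains assms(1) by blast
qed

text \<open>Points picked from the tiles of a sequence converging at infinity are pairwise chained at high
  levels, hence form a Cauchy sequence. Its limit is the point sought: a point sufficiently close to
  the limit is chained to it at a given level.\<close>

lemma natural_identification_surj:
  assumes "mcomplete" "converges_at_infinity X s"
  shows "\<exists>x\<in>S. s \<in> natural_identification X x"
proof -
  note tiles = converges_at_infinity_tiles[OF assms(2)]
  obtain y where y1: "\<And>i. y i \<in> snd (s i)"
    using obtain_points_of_tiles tiles by metis
  have y2: "y i \<in> S" for i
    using y1[of i] tiles[of i] tile_subset unfolding tiles_iff by blast
  have lim: "filterlim (\<lambda>p. gromov_product X (s (fst p)) (s (snd p))) at_top (sequentially \<times>\<^sub>F sequentially)"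
    using assms(2) by (auto simp: converges_at_infinity_def case_prod_unfold)
  have chain: "\<exists>I. \<forall>i\<ge>I. \<forall>j\<ge>I. (y i, y j) \<in> same_tile X k ^^ (4 * w + 4)" for k
  proof -
    have "\<forall>\<^sub>F p in sequentially \<times>\<^sub>F sequentially.
        (y (fst p), y (snd p)) \<in> same_tile X k ^^ (4 * w + 4) \<and> k \<le> fst (s (fst p)) \<and> k \<le> fst (s (snd p))"
      by (rule chain_if_gromov_product_to_infinity[OF lim tiles tiles y1 y1])
    then show ?thesis
      unfolding eventually_prod_sequentially by (metis fst_conv snd_conv)
  qed
  have "MCauchy y"
    unfolding MCauchy_def
  proof (intro conjI allI impI)
    show "range y \<subseteq> S"
      using y2 by blast
  next
    fix e :: real
    assume "0 < e"
    obtain k where k: "\<And>a b. a \<in> S \<Longrightarrow> (a, b) \<in> same_tile X k ^^ (4 * w + 4) \<Longrightarrow> d a b < e"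
      using chains_are_short[OF \<open>0 < e\<close>] by blast
    then show "\<exists>N. \<forall>n n'. N \<le> n \<longrightarrow> N \<le> n' \<longrightarrow> d (y n) (y n') < e"
      using chain[of k] y2 by metis
  qed
  then obtain x where x: "limitin mtopology y x sequentially"
    using assms(1) by (auto simp: mcomplete_def)
  then have "x \<in> S"
    by (simp add: limit_metric_sequentially)
  then obtain g where g: "natural_geodesic X x g"
    using natural_geodesic_exists by blast
  have "(g, s) \<in> infinity_rel X"
  proof (rule infinity_rel_geodesicI[OF g assms(2) y1])
    fix k
    note A = natural_geodesicD(2)[OF g, of k] natural_geodesicD(4)[OF g, of k]
    have "0 < mdiam d (snd (g k)) / C"
      using mdiam_pos[OF A(2)] C_ge_1 by simp
    then obtain N where N: "\<forall>n\<ge>N. d (y n) x < mdiam d (snd (g k)) / C"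
      using x unfolding limit_metric_sequentially by blast
    have "(x, y n) \<in> same_tile X k ^^ (2 * w + 2)" if "N \<le> n" for n
    proof (rule chain_if_dist_less[OF A y2])
      show "C * d x (y n) < mdiam d (snd (g k))"
        using N that C_ge_1 by (simp add: field_simps commute)
    qed
    then show "\<forall>\<^sub>F n in sequentially. (x, y n) \<in> same_tile X k ^^ (2 * w + 2)"
      unfolding eventually_sequentially by blast
  qed
  then show ?thesis
    using \<open>x \<in> S\<close> natural_identification_eq[OF g] by auto
qed

lemma natural_identification_bij:
  assumes "mcomplete"
  shows "bij_betw (natural_identification X) S (boundary_at_infinity X)"
proof -
  have "natural_identification X x \<in> boundary_at_infinity X" if x: "x \<in> S" for x
  proof -
    obtain g where "natural_geodesic X x g"
      using natural_geodesic_exists x by blast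
    then show ?thesis
      using natural_identification_eq natural_geodesic_converges
      by (auto simp: boundary_at_infinity_def intro: quotientI)
  qed
  moreover have "P \<in> natural_identification X ` S" if "P \<in> boundary_at_infinity X" for P
  proof -
    obtain s where s: "P = infinity_rel X `` {s}" "converges_at_infinity X s"
      using \<open>P \<in> boundary_at_infinity X\<close> by (auto simp: boundary_at_infinity_def elim!: quotientE)
    obtain x where x: "x \<in> S" "s \<in> natural_identification X x"
      using natural_identification_surj[OF assms s(2)] by blast
    obtain g where "natural_geodesic X x g"
      using natural_geodesic_exists x by blast
    then have "natural_identification X x = P"
      using x(2) s equiv_class_eq[OF equiv_infinity_rel, of g s] natural_identification_eq by auto
    then show ?thesis
      using x(1) by blast
  qed
  ultimately show ?thesis
    using natural_identification_inj by (auto simp: bij_betw_def inj_on_def)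
qed

section \<open>Gromov products at infinity\<close>

lemma boundary_product_ge:
  assumes "x \<in> S" "y \<in> S" "(x, y) \<in> same_tile X k ^^ N"
  shows "ereal (real k - (real N + 3) / 2) \<le>
    boundary_product X (natural_identification X x) (natural_identification X y)"
proof -
  obtain g h where gh: "natural_geodesic X x g" "natural_geodesic X y h"
    using natural_geodesic_exists assms by metis
  note g = natural_geodesicD[OF gh(1)] and h = natural_geodesicD[OF gh(2)]
  have "\<forall>\<^sub>F i in sequentially. ereal (real k - (real N + 3) / 2) \<le> ereal (gromov_product X (g i) (h i))"
    using eventually_ge_at_top[of k]
    by eventually_elim (simp add: gromov_product_ge[OF g(1) h(1) g(2) h(2) _ _ assms(3)] g h)
  then have "ereal (real k - (real N + 3) / 2) \<le> liminf (\<lambda>i. ereal (gromov_product X (g i) (h i)))"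
    by (rule Liminf_bounded)
  also have "\<dots> \<le> boundary_product X (natural_identification X x) (natural_identification X y)"
  proof -
    have "g \<in> natural_identification X x" "h \<in> natural_identification X y"
      using gh natural_identification_eq natural_geodesic_converges
        equiv_class_self[OF equiv_infinity_rel] by auto
    then show ?thesis
      unfolding boundary_product_def by (intro Sup_upper) blast
  qed
  finally show ?thesis .
qed

text \<open>The supremum in the boundary product runs over sequences \<open>s\<close> and \<open>t\<close> that need not be natural
  geodesics. A chain from \<open>x\<close> to \<open>y\<close> is composed of one from \<open>x\<close> to a tile of \<open>s\<close>, one from there to a
  tile of \<open>t\<close>, and one from there to \<open>y\<close>; this gives the factor 3.\<close>

lemma boundary_product_imp_chain:
  obtains r where "\<And>x y k. x \<in> S \<Longrightarrow> y \<in> S \<Longrightarrow>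
    ereal (real (k + r)) < boundary_product X (natural_identification X x) (natural_identification X y) \<Longrightarrow>
    (x, y) \<in> same_tile X k ^^ (3 * (4 * w + 4))"
proof -
  obtain r where r: "\<And>u v x y k. u \<in> tiles X \<Longrightarrow> v \<in> tiles X \<Longrightarrow> x \<in> snd u \<Longrightarrow> y \<in> snd v \<Longrightarrow>
    real (k + r) \<le> gromov_product X u v \<Longrightarrow> (x, y) \<in> same_tile X k ^^ (4 * w + 4)"
    using gromov_product_imp_chain by blast
  show thesis
  proof (rule that)
    fix x y k
    assume xy: "x \<in> S" "y \<in> S"
      and prod: "ereal (real (k + r)) < boundary_product X (natural_identification X x) (natural_identification X y)"
    obtain g h where gh: "natural_geodesic X x g" "natural_geodesic X y h"
      using natural_geodesic_exists xy by metis
    note g = natural_geodesicD[OF gh(1)] and h = natural_geodesicD[OF gh(2)]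
    obtain s t where st: "(g, s) \<in> infinity_rel X" "(h, t) \<in> infinity_rel X"
      and less: "ereal (real (k + r)) < liminf (\<lambda>i. ereal (gromov_product X (s i) (t i)))"
      using prod natural_identification_eq[OF gh(1)] natural_identification_eq[OF gh(2)]
      by (auto simp: boundary_product_def less_Sup_iff)
    have conv: "converges_at_infinity X s" "converges_at_infinity X t"
      and lims: "filterlim (\<lambda>i. gromov_product X (g i) (s i)) at_top sequentially"
        "filterlim (\<lambda>i. gromov_product X (h i) (t i)) at_top sequentially"
      using st by (auto simp: infinity_rel_def)
    note tiles = conv[THEN converges_at_infinity_tiles]
    obtain a where a: "\<And>i. a i \<in> snd (s i)"
      using obtain_points_of_tiles tiles(1) by metis
    obtain b where b: "\<And>i. b i \<in> snd (t i)"
      using obtain_points_of_tiles tiles(2) by metis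
    have "\<forall>\<^sub>F i in sequentially. (x, y) \<in> same_tile X k ^^ (3 * (4 * w + 4))"
      using chain_if_gromov_product_to_infinity[OF lims(1) g(1) tiles(1) g(2) a, of k]
        chain_if_gromov_product_to_infinity[OF lims(2) h(1) tiles(2) h(2) b, of k] less_LiminfD[OF less]
    proof eventually_elim
      case (elim i)
      have "(a i, b i) \<in> same_tile X k ^^ (4 * w + 4)"
        using r[OF tiles a b] elim(3) by simp
      then have "(x, y) \<in> same_tile X k ^^ ((4 * w + 4) + (4 * w + 4) + (4 * w + 4))"
        using elim(1,2) relpow_trans same_tile_relpow_sym by metis
      moreover have "(4 * w + 4) + (4 * w + 4) + (4 * w + 4) = 3 * (4 * w + 4)"
        by simp
      ultimately show ?case
        by (simp only:)
    qed
    then show "(x, y) \<in> same_tile X k ^^ (3 * (4 * w + 4))"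
      by simp
  qed
qed

lemma level_zero_chain: "x \<in> S \<Longrightarrow> y \<in> S \<Longrightarrow> 0 < N \<Longrightarrow> (x, y) \<in> same_tile X 0 ^^ N"
  by (rule same_tile_relpow_mono[of x y 1]) (auto simp: same_tile_def level_zero)

lemma boundary_product_finite:
  assumes "x \<in> S" "y \<in> S" "x \<noteq> y"
  obtains p where "boundary_product X (natural_identification X x) (natural_identification X y) = ereal p"
    "-2 \<le> p"
proof -
  let ?P = "boundary_product X (natural_identification X x) (natural_identification X y)"
  obtain r where r: "\<And>k. ereal (real (k + r)) < ?P \<Longrightarrow> (x, y) \<in> same_tile X k ^^ (3 * (4 * w + 4))"
    using boundary_product_imp_chain assms by metis
  obtain k where "(x, y) \<notin> same_tile X k ^^ (3 * (4 * w + 4))"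
    using eq_if_all_chains assms by blast
  then have "?P \<le> ereal (real (k + r))"
    using r[of k] by (meson not_le)
  moreover have "ereal (-2) \<le> ?P"
    using boundary_product_ge[OF assms(1,2) level_zero_chain[OF assms(1,2), of 1]] by simp
  ultimately show thesis
    using that by (cases ?P) auto
qed

section \<open>The quasisymmetry estimate\<close>

text \<open>Choose levels \<open>a\<close> close to \<open>p\<close> and \<open>k\<close> close to \<open>q\<close> such that \<open>x\<close> and \<open>z\<close> are chained at level \<open>a\<close>
  while \<open>x\<close> and \<open>y\<close> are not chained at level \<open>k\<close>. Then \<open>d x z\<close> is bounded above by the diameter of an
  \<open>a\<close>-tile at \<open>x\<close> and \<open>d x y\<close> below by that of a \<open>k\<close>-tile at \<open>x\<close>. For \<open>a \<le> k\<close> the diameters are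
  compared by the fastest possible decay, a factor \<open>C\<close> per level, and for \<open>k \<le> a\<close> by the
  guaranteed decay, a factor \<open>rho\<close> per level. The base \<open>C + 1\<close> replaces \<open>C\<close>, which might be \<open>1\<close>.\<close>

lemma dist_ratio_ge_power:
  obtains c1 c2 where "0 < c1" "0 < c2"
    "\<And>x y z p q. x \<in> S \<Longrightarrow> y \<in> S \<Longrightarrow> z \<in> S \<Longrightarrow> x \<noteq> y \<Longrightarrow> x \<noteq> z \<Longrightarrow>
      boundary_product X (natural_identification X x) (natural_identification X z) = ereal p \<Longrightarrow>
      boundary_product X (natural_identification X x) (natural_identification X y) = ereal q \<Longrightarrow>
      (C + 1) powr (p - q) \<le> c1 * (d x y / d x z) \<or> (1 / rho) powr (p - q) \<le> c2 * (d x y / d x z)"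
proof -
  define N where "N = 3 * (4 * w + 4)"
  obtain r where r: "\<And>x y k. x \<in> S \<Longrightarrow> y \<in> S \<Longrightarrow>
    ereal (real (k + r)) < boundary_product X (natural_identification X x) (natural_identification X y) \<Longrightarrow>
    (x, y) \<in> same_tile X k ^^ N"
    using boundary_product_imp_chain unfolding N_def by blast
  define M where "M = real N * C ^ N"
  define h where "h = (real (2 * w + 2) + 3) / 2"
  define e where "e = real r + h + 2"
  have "0 < M"
    using C_ge_1 by (simp add: M_def N_def)
  have "5 / 2 \<le> h"
    by (simp add: h_def)
  \<comment> \<open>The levels \<open>a\<close> and \<open>k\<close> chosen below satisfy \<open>p - q - e \<le> a - k\<close>. Both cases \<open>a \<le> k\<close> and
    \<open>k \<le> a\<close> end with an estimate of this form, for either base \<open>b\<close>.\<close>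
  have base: "b powr (p - q) \<le> b powr e * (M * (c * C)) * (d x y / d x z)"
    if b: "1 < b" and xz: "0 < d x z" "d x z \<le> M * D" and E: "E \<le> C * d x y" "0 \<le> c"
      and DE: "b powr (p - q - e) * D \<le> c * E"
    for b p q c D E :: real and x y z
  proof -
    have "b powr (p - q - e) * d x z \<le> b powr (p - q - e) * (M * D)"
      using xz by (intro mult_left_mono) auto
    also have "\<dots> = M * (b powr (p - q - e) * D)"
      by simp
    also have "\<dots> \<le> M * (c * (C * d x y))"
      using \<open>0 < M\<close> E by (intro mult_left_mono order_trans[OF DE]) auto
    finally have "b powr (p - q - e) \<le> M * (c * C) * (d x y / d x z)"
      using xz by (simp add: field_simps)
    then have "b powr e * b powr (p - q - e) \<le> b powr e * (M * (c * C) * (d x y / d x z))"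
      by (intro mult_left_mono) auto
    then show ?thesis
      using b by (simp flip: powr_add add: ac_simps)
  qed
  show thesis
  proof (rule that)
    show "0 < (C + 1) powr e * (M * (C * C))" "0 < (1 / rho) powr e * (M * (K * C))"
      using \<open>0 < M\<close> C_ge_1 K_ge_1 rho_pos by simp_all
  next
    fix x y z and p q :: real
    assume xyz: "x \<in> S" "y \<in> S" "z \<in> S" "x \<noteq> y" "x \<noteq> z"
      and p: "boundary_product X (natural_identification X x) (natural_identification X z) = ereal p"
      and q: "boundary_product X (natural_identification X x) (natural_identification X y) = ereal q"
    have "-2 \<le> q"
      using boundary_product_finite[OF xyz(1,2,4)] q by (metis ereal.inject)
    \<comment> \<open>The rounded-up level may be negative; then level \<open>0\<close> serves, where all points are chained.\<close>
    define a where "a = nat (\<lceil>p - r - 1\<rceil>)"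
    define k where "k = nat (\<lfloor>q + h\<rfloor> + 1)"
    have a: "p - r - 1 \<le> a" "a = 0 \<or> a + r < p"
      unfolding a_def by linarith+
    have k: "q + h < k" "k \<le> q + h + 1"
      using \<open>-2 \<le> q\<close> \<open>5 / 2 \<le> h\<close> unfolding k_def by linarith+
    have ak: "p - q - e \<le> real a - real k"
      using a k unfolding e_def by linarith
    obtain A where A: "A \<in> X a" "x \<in> A"
      using tile_through xyz by blast
    obtain B where B: "B \<in> X k" "x \<in> B"
      using tile_through xyz by blast
    have "(x, z) \<in> same_tile X a ^^ N"
      using a(2)
    proof
      assume "a = 0"
      then show ?thesis
        using level_zero_chain[OF xyz(1,3)] by (simp add: N_def)
    next
      assume "a + r < p"
      then show ?thesis
        using r[OF xyz(1,3), of a] p by simp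
    qed
    then have xz: "d x z \<le> M * mdiam d A"
      using chain_dist_le A by (simp add: M_def)
    have "(x, y) \<notin> same_tile X k ^^ (2 * w + 2)"
    proof
      assume "(x, y) \<in> same_tile X k ^^ (2 * w + 2)"
      from boundary_product_ge[OF xyz(1,2) this] have "real k - h \<le> q"
        by (simp add: q h_def)
      then show False
        using k by simp
    qed
    then have xy: "mdiam d B \<le> C * d x y"
      using chain_if_dist_less[OF B(2,1) xyz(2)] by (meson not_le)
    have pos: "0 < d x z"
      using xyz by simp
    show "(C + 1) powr (p - q) \<le> (C + 1) powr e * (M * (C * C)) * (d x y / d x z) \<or>
      (1 / rho) powr (p - q) \<le> (1 / rho) powr e * (M * (K * C)) * (d x y / d x z)"
    proof (cases "a \<le> k")
      case True
      then obtain j where j: "k = a + j"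
        using le_Suc_ex by blast
      have "mdiam d A \<le> C * (C ^ j * mdiam d B)"
        using mdiam_growth_le(1)[of x A B a j] A B j by (simp add: ac_simps)
      also have "\<dots> \<le> C * ((C + 1) ^ j * mdiam d B)"
        using C_ge_1 mdiam_nonneg[OF B(1)] by (intro mult_left_mono mult_right_mono power_mono) auto
      finally have AB: "mdiam d A \<le> C * mdiam d B * (C + 1) powr j"
        using C_ge_1 by (simp add: powr_realpow ac_simps)
      have "(C + 1) powr (p - q - e) * mdiam d A \<le> (C + 1) powr (- real j) * (C * mdiam d B * (C + 1) powr j)"
        using ak j C_ge_1 mdiam_nonneg[OF A(1)] by (intro mult_mono AB powr_mono) auto
      also have "\<dots> = C * mdiam d B"
        using C_ge_1 by (simp add: powr_minus)
      finally show ?thesis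
        using base[of "C + 1" x z _ _ y C p q] pos xz xy C_ge_1 by auto
    next
      case False
      then obtain j where j: "a = k + j"
        using le_Suc_ex nat_le_linear by blast
      have "rho ^ j = (1 / rho) powr (- real j)"
        using rho_pos by (simp add: powr_minus powr_realpow power_one_over)
      then have AB: "mdiam d A \<le> K * mdiam d B * (1 / rho) powr (- real j)"
        using mdiam_decay[of x B A k j] A B j by (simp add: ac_simps)
      have "(1 / rho) powr (p - q - e) * mdiam d A \<le> (1 / rho) powr j * (K * mdiam d B * (1 / rho) powr (- real j))"
        using ak j rho_pos rho_less_1 mdiam_nonneg[OF A(1)] by (intro mult_mono AB powr_mono) auto
      also have "\<dots> = K * mdiam d B"
        using rho_pos by (simp add: powr_minus)
      finally show ?thesis
        using base[of "1 / rho" x z _ _ y K p q] pos xz xy K_ge_1 rho_pos rho_less_1 by auto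
    qed
  qed
qed

lemma natural_identification_quasisymmetry:
  assumes "mcomplete" "visual_metric X D"
  shows "quasisymmetry S d (boundary_at_infinity X) D (natural_identification X)"
proof -
  let ?\<Phi> = "natural_identification X"
  have bij: "bij_betw ?\<Phi> S (boundary_at_infinity X)"
    by (rule natural_identification_bij[OF assms(1)])
  interpret B: Metric_space "boundary_at_infinity X" D
    using assms(2) by (simp add: visual_metric_def)
  obtain L V where L: "1 < L" and V: "1 \<le> V"
    and vis: "\<And>P Q. P \<in> boundary_at_infinity X \<Longrightarrow> Q \<in> boundary_at_infinity X \<Longrightarrow>
      1 / V * neg_power L (boundary_product X P Q) \<le> D P Q \<and> D P Q \<le> V * neg_power L (boundary_product X P Q)"
    using assms(2) unfolding visual_metric_def by blast
  obtain c1 c2 where c: "0 < c1" "0 < c2"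
    and ratio: "\<And>x y z p q. x \<in> S \<Longrightarrow> y \<in> S \<Longrightarrow> z \<in> S \<Longrightarrow> x \<noteq> y \<Longrightarrow> x \<noteq> z \<Longrightarrow>
      boundary_product X (?\<Phi> x) (?\<Phi> z) = ereal p \<Longrightarrow> boundary_product X (?\<Phi> x) (?\<Phi> y) = ereal q \<Longrightarrow>
      (C + 1) powr (p - q) \<le> c1 * (d x y / d x z) \<or> (1 / rho) powr (p - q) \<le> c2 * (d x y / d x z)"
    using dist_ratio_ge_power by blast
  define \<alpha> where "\<alpha> = log (C + 1) L"
  define \<beta> where "\<beta> = log (1 / rho) L"
  have exponents: "0 < \<alpha>" "0 < \<beta>"
    using L C_ge_1 rho_pos rho_less_1 by (auto simp: \<alpha>_def \<beta>_def)
  define G where "G = V * V * max (c1 powr \<alpha>) (c2 powr \<beta>)"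
  have "0 < G"
    using V c by (simp add: G_def less_max_iff_disj)
  define \<eta> where "\<eta> t = G * max (t powr \<alpha>) (t powr \<beta>)" for t
  have "D (?\<Phi> x) (?\<Phi> y) / D (?\<Phi> x) (?\<Phi> z) \<le> \<eta> (d x y / d x z)"
    if xyz: "x \<in> S" "y \<in> S" "z \<in> S" "x \<noteq> z" for x y z
  proof (cases "x = y")
    case True
    have "?\<Phi> x \<in> boundary_at_infinity X"
      using bij xyz(1) by (rule bij_betwE[THEN bspec])
    then show ?thesis
      using True \<open>0 < G\<close> by (simp add: \<eta>_def le_max_iff_disj)
  next
    case False
    define t where "t = d x y / d x z"
    have "0 \<le> t"
      by (simp add: t_def)
    have mem: "?\<Phi> x \<in> boundary_at_infinity X" "?\<Phi> y \<in> boundary_at_infinity X" "?\<Phi> z \<in> boundary_at_infinity X"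
      using bij xyz bij_betwE by blast+
    obtain p where p: "boundary_product X (?\<Phi> x) (?\<Phi> z) = ereal p"
      using boundary_product_finite[OF xyz(1,3,4)] by blast
    obtain q where q: "boundary_product X (?\<Phi> x) (?\<Phi> y) = ereal q"
      using boundary_product_finite[OF xyz(1,2) False] by blast
    have "D (?\<Phi> x) (?\<Phi> y) / D (?\<Phi> x) (?\<Phi> z) \<le> (V * L powr (- q)) / (1 / V * L powr (- p))"
      using vis[OF mem(1,2)] vis[OF mem(1,3)] V L
      by (intro frac_le) (auto simp: neg_power_def p q)
    also have "\<dots> = V * V * L powr (p - q)"
      using V L by (simp add: powr_diff powr_minus field_simps)
    also have "L powr (p - q) \<le> max (c1 powr \<alpha>) (c2 powr \<beta>) * max (t powr \<alpha>) (t powr \<beta>)"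
      using ratio[OF xyz(1-3) False xyz(4) p q]
    proof
      assume "(C + 1) powr (p - q) \<le> c1 * (d x y / d x z)"
      then have "L powr (p - q) \<le> c1 powr \<alpha> * t powr \<alpha>"
        unfolding \<alpha>_def t_def using C_ge_1 L c \<open>0 \<le> t\<close>
        by (intro powr_change_base_le) (auto simp: t_def)
      also have "\<dots> \<le> max (c1 powr \<alpha>) (c2 powr \<beta>) * max (t powr \<alpha>) (t powr \<beta>)"
        by (intro mult_mono) (auto simp: le_max_iff_disj)
      finally show ?thesis .
    next
      assume "(1 / rho) powr (p - q) \<le> c2 * (d x y / d x z)"
      then have "L powr (p - q) \<le> c2 powr \<beta> * t powr \<beta>"
        unfolding \<beta>_def t_def using rho_pos rho_less_1 L c \<open>0 \<le> t\<close>
        by (intro powr_change_base_le) (auto simp: t_def)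
      also have "\<dots> \<le> max (c1 powr \<alpha>) (c2 powr \<beta>) * max (t powr \<alpha>) (t powr \<beta>)"
        by (intro mult_mono) (auto simp: le_max_iff_disj)
      finally show ?thesis .
    qed
    also have "V * V * (max (c1 powr \<alpha>) (c2 powr \<beta>) * max (t powr \<alpha>) (t powr \<beta>)) = \<eta> t"
      by (simp add: \<eta>_def G_def)
    finally show ?thesis
      using V by (simp add: t_def)
  qed
  moreover have "\<exists>\<eta>'. homeomorphism {0..} {0..} \<eta> \<eta>'"
    unfolding \<eta>_def using homeomorphism_max_powr[OF \<open>0 < G\<close> exponents] by blast
  ultimately show ?thesis
    using bij unfolding quasisymmetry_def by blast
qed

end

theorem proposition10p8:
  fixes S :: "'a set"
    and d :: "'a \<Rightarrow> 'a \<Rightarrow> real"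
    and X :: "nat \<Rightarrow> 'a set set"
    and d_inf :: "(nat \<Rightarrow> nat \<times> 'a set) set \<Rightarrow> (nat \<Rightarrow> nat \<times> 'a set) set \<Rightarrow> real"
  assumes "Metric_space S d"
    and "Metric_space.mcomplete S d"
    and "Metric_space.mbounded S d S"
    and "\<exists>w. quasi_visual_approximation S d w X"
    and "\<forall>n. \<forall>A\<in>X n. A \<noteq> {}"
    and "visual_metric X d_inf"
  shows "quasisymmetry S d (boundary_at_infinity X) d_inf (natural_identification X)"
proof -
  obtain w where w: "quasi_visual_approximation S d w X"
    using assms(4) by blast
  then obtain C k0 lam where const: "1 \<le> C \<and> 1 \<le> k0 \<and> 0 < lam \<and> lam < 1"
    and conditions: "\<forall>n.
      (\<forall>A\<in>X n. \<forall>B\<in>X n. A \<inter> B \<noteq> {} \<longrightarrow>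
        1 / C * mdiam d B \<le> mdiam d A \<and> mdiam d A \<le> C * mdiam d B) \<and>
      (\<forall>A\<in>X n. \<forall>B\<in>X n. A \<noteq> {} \<and> B \<noteq> {} \<and> tile_nbhd (X n) w A \<inter> tile_nbhd (X n) w B = {} \<longrightarrow>
        msetdist d A B \<ge> 1 / C * mdiam d A) \<and>
      (\<forall>A\<in>X n. \<forall>B\<in>X (n + 1). A \<inter> B \<noteq> {} \<longrightarrow>
        1 / C * mdiam d B \<le> mdiam d A \<and> mdiam d A \<le> C * mdiam d B) \<and>
      (\<forall>A\<in>X n. \<forall>B\<in>X (n + k0). A \<inter> B \<noteq> {} \<longrightarrow> mdiam d B \<le> lam * mdiam d A)"
    unfolding quasi_visual_approximation_def by (elim conjE exE) (rule that, simp_all only: simp_thms)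
  have level: "mdiam d A \<le> C * mdiam d B" if "A \<in> X n" "B \<in> X n" "A \<inter> B \<noteq> {}" for n A B
    using conditions[THEN spec, THEN conjunct1] that by simp
  have separated: "1 / C * mdiam d A \<le> msetdist d A B"
    if "A \<in> X n" "B \<in> X n" "tile_nbhd (X n) w A \<inter> tile_nbhd (X n) w B = {}" for n A B
    using conditions[THEN spec, THEN conjunct2, THEN conjunct1] that assms(5) by simp
  have child: "1 / C * mdiam d B \<le> mdiam d A" "mdiam d A \<le> C * mdiam d B"
    if "A \<in> X n" "B \<in> X (n + 1)" "A \<inter> B \<noteq> {}" for n A B
    using conditions[THEN spec, THEN conjunct2, THEN conjunct2, THEN conjunct1] that by simp_all
  have shrink: "mdiam d B \<le> lam * mdiam d A" if "A \<in> X n" "B \<in> X (n + k0)" "A \<inter> B \<noteq> {}" for n A B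
    using conditions[THEN spec, THEN conjunct2, THEN conjunct2, THEN conjunct2] that by simp
  interpret Metric_space S d
    by fact
  interpret tile_approximation S d X w k0 C lam
  proof unfold_locales
    show "\<exists>x\<in>S. \<exists>y\<in>S. x \<noteq> y" "\<And>n. \<Union> (X n) = S" "X 0 = {S}"
      using w by (simp_all add: quasi_visual_approximation_def)
    show "mdiam d A \<le> C * msetdist d A B"
      if "A \<in> X n" "B \<in> X n" "tile_nbhd (X n) w A \<inter> tile_nbhd (X n) w B = {}" for A B n
      using separated[OF that] const by (simp add: field_simps)
    show "mdiam d A \<le> C * mdiam d B" "mdiam d B \<le> C * mdiam d A"
      if "A \<in> X n" "B \<in> X (Suc n)" "A \<inter> B \<noteq> {}" for A B n
      using child[of A n B] that const by (auto simp: field_simps)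
  qed (use assms const level shrink in auto)
  show ?thesis
    using natural_identification_quasisymmetry assms by blast
qed

end
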